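(* Let $\mathcal{A}=(\mathcal{A}_n)_{n\ge0}$ be an exponential sequence of arrangements, and for $\ell\ge0$ let $R_\ell(\mathcal{A};x)=\sum_{n\ge0}r_\ell(\mathcal{A}_n)\frac{x^n}{n!}$. Then for every $\ell\ge0$, \[R_\ell(\mathcal{A};x)=R_1(\mathcal{A};x)^\ell.\] Moreover, for all integers $\ell_1,\ell_2\ge0$ and all $n\ge0$, \[r_{\ell_1+\ell_2}(\mathcal{A}_n)=\sum_{i=0}^n\binom{n}{i}r_{\ell_1}(\mathcal{A}_i)\,r_{\ell_2}(\mathcal{A}_{n-i}).\]
   Context: $\operatorname{Braid}(n)=\{\{x_i-x_j=0\}:1\le i<j\le n\}$ in $\mathbb{R}^n$. For $H=\{w\cdot x=a\}$, $\underline{H}=\{w\cdot x=0\}$ and $\underline{\mathcal{A}}=\{\underline{H}:H\in\mathcal{A}\}$. $\mathcal{L}(\mathcal{B})$ is the poset of nonempty intersections of subsets of hyperplanes of $\mathcal{B}$, ordered by reverse inclusion. Localization: $\mathcal{A}_V=\{H\in\mathcal{A}:V\subseteq H\text{ or }V\cap H=\emptyset\}$. An exponential sequence of arrangements is a sequence with $\mathcal{A}_n$ an arrangement in $\mathbb{R}^n$ such that (1) $\underline{\mathcal{A}_n}=\operatorname{Braid}(n)$ (each hyperplane of $\mathcal{A}_n$ is parallel to some $x_i-x_j=0$ and each such has a parallel hyperplane in $\mathcal{A}_n$), and (2) for every $S\subseteq\{1,\dots,n\}$, with $V_S=\{x:x_i=x_j\ \forall i,j\in S\}$, $\mathcal{L}((\mathcal{A}_n)_{V_S})\cong\mathcal{L}(\mathcal{A}_{|S|})$;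 $\mathcal{A}_0$ is the empty arrangement in $\mathbb{R}^0$, which has a single region, of level $0$. For a region $R$ (connected component of the complement), $\operatorname{Rec}(R)=\{v:R+v\subseteq R\}$ and its level is $\ell(R)=\dim\operatorname{Rec}(R)$ (dimension of its linear span); $r_\ell(\mathcal{B})$ is the number of regions of $\mathcal{B}$ of level $\ell$. *)

theory Defs
  imports
    "HOL-Analysis.Analysis"
    "HOL-Library.Function_Algebras"
begin

text \<open>
  \<open>\<real>\<^sup>n\<close> is the library's \<^const>\<open>Euclidean_space\<close> \<open>n\<close>: functions \<open>nat \<Rightarrow> real\<close> supported on
  \<open>{..<n}\<close>, so coordinates are numbered from \<open>0\<close>. Its vector space operations are pointwise;
  the scalar multiplication below is what makes \<open>span\<close> and \<open>dim\<close> available.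
\<close>

instantiation "fun" :: (type, real_vector) real_vector
begin

definition scaleR_fun :: "real \<Rightarrow> ('a \<Rightarrow> 'b) \<Rightarrow> 'a \<Rightarrow> 'b"
  where "scaleR_fun c f = (\<lambda>x. c *\<^sub>R f x)"

instance
  by standard (simp_all add: scaleR_fun_def fun_eq_iff scaleR_add_right scaleR_add_left)

end

abbreviation Rn :: "nat \<Rightarrow> (nat \<Rightarrow> real) set"
  where "Rn n \<equiv> topspace (Euclidean_space n)"

definition hyperplane :: "nat \<Rightarrow> (nat \<Rightarrow> real) \<Rightarrow> real \<Rightarrow> (nat \<Rightarrow> real) set"
  where "hyperplane n w a = {x \<in> Rn n. (\<Sum>i<n. w i * x i) = a}"

definition arrangement :: "nat \<Rightarrow> (nat \<Rightarrow> real) set set \<Rightarrow> bool"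
  where "arrangement n \<B> \<longleftrightarrow>
    finite \<B> \<and> (\<forall>H\<in>\<B>. \<exists>w\<in>Rn n. \<exists>a. w \<noteq> 0 \<and> H = hyperplane n w a)"

definition Braid :: "nat \<Rightarrow> (nat \<Rightarrow> real) set set"
  where "Braid n = {{x \<in> Rn n. x i - x j = 0} | i j. i < j \<and> j < n}"

definition underline_arr :: "nat \<Rightarrow> (nat \<Rightarrow> real) set set \<Rightarrow> (nat \<Rightarrow> real) set set"
  where "underline_arr n \<B> =
    {hyperplane n w 0 | w a. w \<in> Rn n \<and> w \<noteq> 0 \<and> hyperplane n w a \<in> \<B>}"

text \<open>The flats include the whole space, as the intersection of the empty family.\<close>

definition flats :: "nat \<Rightarrow> (nat \<Rightarrow> real) set set \<Rightarrow> (nat \<Rightarrow> real) set set"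
  where "flats n \<B> = {X. X \<noteq> {} \<and> (\<exists>\<C>\<subseteq>\<B>. X = Rn n \<inter> \<Inter>\<C>)}"

definition rev_incl_iso :: "'a set set \<Rightarrow> 'b set set \<Rightarrow> bool"
  where "rev_incl_iso \<X> \<Y> \<longleftrightarrow>
    (\<exists>f. bij_betw f \<X> \<Y> \<and> (\<forall>X\<in>\<X>. \<forall>X'\<in>\<X>. X \<supseteq> X' \<longleftrightarrow> f X \<supseteq> f X'))"

definition localization :: "(nat \<Rightarrow> real) set set \<Rightarrow> (nat \<Rightarrow> real) set \<Rightarrow> (nat \<Rightarrow> real) set set"
  where "localization \<B> V = {H \<in> \<B>. V \<subseteq> H \<or> V \<inter> H = {}}"

definition diag_subspace :: "nat \<Rightarrow> nat set \<Rightarrow> (nat \<Rightarrow> real) set"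
  where "diag_subspace n S = {x \<in> Rn n. \<forall>i\<in>S. \<forall>j\<in>S. x i = x j}"

definition exponential_sequence :: "(nat \<Rightarrow> (nat \<Rightarrow> real) set set) \<Rightarrow> bool"
  where "exponential_sequence \<A> \<longleftrightarrow>
    (\<forall>n. arrangement n (\<A> n)
       \<and> underline_arr n (\<A> n) = Braid n
       \<and> (\<forall>S\<subseteq>{..<n}.
            rev_incl_iso (flats n (localization (\<A> n) (diag_subspace n S)))
                         (flats (card S) (\<A> (card S)))))"

definition regions :: "nat \<Rightarrow> (nat \<Rightarrow> real) set set \<Rightarrow> (nat \<Rightarrow> real) set set"
  where "regions n \<B> = connected_components_of (subtopology (Euclidean_space n) (Rn n - \<Union>\<B>))"

definition Rec :: "nat \<Rightarrow> (nat \<Rightarrow> real) set \<Rightarrow> (nat \<Rightarrow> real) set"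
  where "Rec n R = {v \<in> Rn n. (\<lambda>x. x + v) ` R \<subseteq> R}"

definition level :: "nat \<Rightarrow> (nat \<Rightarrow> real) set \<Rightarrow> nat"
  where "level n R = dim (span (Rec n R))"

definition num_regions_of_level :: "nat \<Rightarrow> nat \<Rightarrow> (nat \<Rightarrow> real) set set \<Rightarrow> nat"
  where "num_regions_of_level l n \<B> = card {R \<in> regions n \<B>. level n R = l}"

definition level_egf :: "nat \<Rightarrow> (nat \<Rightarrow> (nat \<Rightarrow> real) set set) \<Rightarrow> real fps"
  where "level_egf l \<A> = Abs_fps (\<lambda>n. real (num_regions_of_level l n (\<A> n)) / fact n)"

end

theory Submission
  imports Defs
begin

text \<open>
  Let \<open>D i j\<close> be the set of offsets \<open>a\<close> with \<open>{x\<^sub>i - x\<^sub>j = a}\<close> in the arrangement. A region is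
  determined by its pattern, the set of triples \<open>(i, j, a)\<close> with \<open>a \<in> D i j\<close> and \<open>x\<^sub>i - x\<^sub>j < a\<close> on
  the region. Reading \<open>(i, j, a)\<close> as an arc from \<open>i\<close> to \<open>j\<close> gives a digraph in which any two vertices
  are joined, since every \<open>D i j\<close> is nonempty; its strong components are therefore linearly ordered,
  the recession cone consists of the vectors that are constant on components and weakly monotone along
  this order, and the level is the number of components. Cutting the order after the first \<open>k\<close>
  components splits a pattern of level \<open>k + l\<close> on \<open>S\<close> into patterns of level \<open>k\<close> on some \<open>T \<subseteq> S\<close> and
  of level \<open>l\<close> on \<open>S - T\<close>, and every such pair arises, by moving one part far away from the other.
  This gives the convolution identity for the counts on subsets \<open>S\<close> of the coordinates of one
  arrangement.

  It remains to see that the count on \<open>S\<close> agrees with that of the arrangement of index \<open>card S\<close>.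
  By Whitney's formula, a consequence of deletion and restriction, the total number of regions depends
  only on the poset of flats, so the totals agree. The convolution expresses the counts of level at
  least \<open>2\<close> through smaller subsets, and the total then fixes the count of level \<open>1\<close>.
\<close>

section \<open>Whitney's formula for the number of regions\<close>

definition affine_fun :: "('v::real_vector \<Rightarrow> real) \<Rightarrow> bool"
  where "affine_fun f \<longleftrightarrow> (\<forall>x p q c. f (x + c *\<^sub>R (q - p)) = f x + c * (f q - f p))"

lemma affine_funD: "affine_fun f \<Longrightarrow> f (x + c *\<^sub>R (q - p)) = f x + c * (f q - f p)"
  by (simp add: affine_fun_def)

lemma affine_line: "affine E \<Longrightarrow> x \<in> E \<Longrightarrow> p \<in> E \<Longrightarrow> q \<in> E \<Longrightarrow> x + c *\<^sub>R (q - p) \<in> E"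
  using mem_affine_3_minus by blast

definition zeros :: "'v set \<Rightarrow> ('i \<Rightarrow> 'v \<Rightarrow> real) \<Rightarrow> 'i set \<Rightarrow> 'v set"
  where "zeros E f I = {x \<in> E. \<forall>i\<in>I. f i x = 0}"

lemma affine_zeros:
  fixes E :: "'v::real_vector set"
  assumes "affine E" "\<And>i. i \<in> I \<Longrightarrow> affine_fun (f i)"
  shows "affine (zeros E f I)"
  unfolding affine_def
proof (intro ballI allI impI)
  fix x y u v assume xy: "x \<in> zeros E f I" "y \<in> zeros E f I" and uv: "u + v = (1::real)"
  have "u = 1 - v" using uv by simp
  then have eq: "u *\<^sub>R x + v *\<^sub>R y = x + v *\<^sub>R (y - x)"
    by (simp only:) (simp add: algebra_simps)
  show "u *\<^sub>R x + v *\<^sub>R y \<in> zeros E f I"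
    unfolding eq using xy affine_line[OF assms(1)] affine_funD[OF assms(2)]
    by (auto simp: zeros_def)
qed

definition directions :: "'v::real_vector set \<Rightarrow> 'v set"
  where "directions X = {x - y | x y. x \<in> X \<and> y \<in> X}"

text \<open>For a nonempty affine set this is the affine dimension; the empty set gets
  \<open>0\<close>, a value that \<open>whitney_sum\<close> never reads.\<close>

definition adim :: "'v::real_vector set \<Rightarrow> nat"
  where "adim X = dim (directions X)"

lemma subspace_directions:
  assumes "affine X" "X \<noteq> {}"
  shows "subspace (directions X)"
proof -
  obtain p where p: "p \<in> X" using assms by auto
  have eq: "directions X = (\<lambda>x. x - p) ` X"
  proof
    show "directions X \<subseteq> (\<lambda>x. x - p) ` X"
    proof
      fix v assume "v \<in> directions X"
      then obtain x y where "x \<in> X" "y \<in> X" "v = x - y" by (auto simp: directions_def)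
      then have "p + 1 *\<^sub>R (x - y) \<in> X" and "v = (p + 1 *\<^sub>R (x - y)) - p"
        using affine_line[OF assms(1) p] by (blast, simp)
      then show "v \<in> (\<lambda>x. x - p) ` X" by blast
    qed
  qed (use p in \<open>auto simp: directions_def\<close>)
  show ?thesis
    unfolding eq using affine_diffs_subspace_subtract[OF assms(1) p] by simp
qed

text \<open>On the direction space of \<open>X\<close>, \<open>f\<close> acts as a nonzero linear
  functional whose kernel is the direction space of the zero set; so a basis of the latter together
  with \<open>q - p\<close> is a basis of the former. Containment in \<open>span B\<close> keeps
  this basis finite, so that \<open>card\<close> sees the extra vector.\<close>

lemma adim_zeros_insert:
  fixes X :: "'v::real_vector set"
  assumes X: "affine X" and B: "finite B" "X \<subseteq> span B"
    and f: "affine_fun f" and p: "p \<in> X" "f p = 0" and q: "q \<in> X" "f q \<noteq> 0"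
  shows "adim X = Suc (adim {x \<in> X. f x = 0})"
proof -
  define Y where "Y = {x \<in> X. f x = 0}"
  have "affine Y"
    using affine_zeros[OF X, of "{()}" "\<lambda>_. f"] f by (simp add: zeros_def Y_def)
  have pY: "p \<in> Y" using p by (simp add: Y_def)
  have sY: "subspace (directions Y)" using \<open>affine Y\<close> pY by (intro subspace_directions) auto
  have dB: "directions Y \<subseteq> span B"
    using B by (auto simp: directions_def Y_def intro!: span_diff)
  obtain C where C: "C \<subseteq> directions Y" "independent C" "directions Y \<subseteq> span C"
    using maximal_independent_subset by blast
  have spC: "span C = directions Y" using C sY by (meson span_minimal subset_antisym)
  have "finite C" using independent_span_bound[OF B(1) C(2)] C(1) dB by blast
  have new: "q - p \<notin> span C"
  proof
    assume "q - p \<in> span C"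
    then obtain x y where xy: "x \<in> Y" "y \<in> Y" "q - p = x - y" unfolding spC by (auto simp: directions_def)
    have "f q = f (p + 1 *\<^sub>R (x - y))" by (simp flip: xy(3))
    also have "\<dots> = 0" unfolding affine_funD[OF f] using xy p by (simp add: Y_def)
    finally show False using q by simp
  qed
  have ins: "independent (insert (q - p) C)" using new C(2) by (simp add: independent_insert)
  have dir: "x - p \<in> span (insert (q - p) C)" if "x \<in> X" for x
  proof -
    \<comment> \<open>\<open>x\<close> is slid along \<open>q - p\<close> into the zero set; since
      \<open>f p = 0\<close>, this direction changes \<open>f\<close> at rate
      \<open>f q\<close>.\<close>
    define y where "y = x + (- (f x / f q)) *\<^sub>R (q - p)"
    have "f y = 0" unfolding y_def affine_funD[OF f] using p q by simp
    moreover have "y \<in> X" unfolding y_def by (rule affine_line[OF X that p(1) q(1)])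
    ultimately have "y \<in> Y" by (simp add: Y_def)
    then have "y - p \<in> span C" unfolding spC using pY by (auto simp: directions_def)
    then have "y - p \<in> span (insert (q - p) C)" using span_mono[of C] by blast
    moreover have "(f x / f q) *\<^sub>R (q - p) \<in> span (insert (q - p) C)"
      by (intro span_scale span_base) simp
    moreover have "x - p = (y - p) + (f x / f q) *\<^sub>R (q - p)" by (simp add: y_def)
    ultimately show ?thesis by (metis span_add)
  qed
  have "directions X \<subseteq> span (insert (q - p) C)"
  proof
    fix v assume "v \<in> directions X"
    then obtain x y where "x \<in> X" "y \<in> X" "v = (x - p) - (y - p)" by (auto simp: directions_def)
    then show "v \<in> span (insert (q - p) C)" using dir span_diff by blast
  qed
  moreover have "insert (q - p) C \<subseteq> directions X"
    using C(1) p q unfolding directions_def Y_def by blast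
  ultimately have "dim (directions X) = card (insert (q - p) C)"
    using ins by (intro dim_unique[of "insert (q - p) C"]) auto
  also have "\<dots> = Suc (card C)" using new \<open>finite C\<close> by (simp add: span_base card_insert_if) (metis span_base)
  also have "card C = dim (directions Y)"
    using C by (intro dim_unique[symmetric]) auto
  finally show ?thesis by (simp add: adim_def Y_def)
qed

text \<open>The chambers of the arrangement of the zero sets of \<open>f i\<close>, \<open>i \<in> I\<close>, inside \<open>E\<close> are recorded
  by their sign vectors.\<close>

definition chambers :: "'v set \<Rightarrow> ('i \<Rightarrow> 'v \<Rightarrow> real) \<Rightarrow> 'i set \<Rightarrow> 'i set set"
  where "chambers E f I = (\<lambda>x. {i \<in> I. f i x > 0}) ` {x \<in> E. \<forall>i\<in>I. f i x \<noteq> 0}"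

text \<open>Both signs of \<open>s\<close> are covered because \<open>deletion_restriction\<close>
  leaves a hyperplane towards either side.\<close>

lemma perturb_same_chamber:
  fixes f :: "'i \<Rightarrow> 'v::real_vector \<Rightarrow> real"
  assumes "finite I" "\<And>i. i \<in> I \<Longrightarrow> affine_fun (f i)" "\<And>i. i \<in> I \<Longrightarrow> f i x \<noteq> 0"
  obtains t :: real where "t > 0"
    "\<And>i s. i \<in> I \<Longrightarrow> \<bar>s\<bar> = t \<Longrightarrow> f i (x + s *\<^sub>R v) \<noteq> 0 \<and> (f i (x + s *\<^sub>R v) > 0 \<longleftrightarrow> f i x > 0)"
proof -
  \<comment> \<open>The slope of \<open>f i\<close> along \<open>v\<close>.\<close>
  define k where "k i = f i v - f i 0" for i
  have lin: "f i (x + s *\<^sub>R v) = f i x + s * k i" if "i \<in> I" for i s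
    using affine_funD[OF assms(2)[OF that], of x s v 0] by (simp add: k_def)
  have "\<exists>t>0. \<forall>i\<in>I. t * \<bar>k i\<bar> < \<bar>f i x\<bar>"
    using assms(1,3)
  proof (induction I)
    case empty
    then show ?case by (auto intro: exI[of _ 1])
  next
    case (insert i I)
    then obtain t where t: "t > 0" "\<forall>j\<in>I. t * \<bar>k j\<bar> < \<bar>f j x\<bar>" by auto
    \<comment> \<open>The \<open>1 +\<close> keeps the denominator positive when the slope is
      \<open>0\<close> and makes the resulting bound strict.\<close>
    define u where "u = min t (\<bar>f i x\<bar> / (1 + \<bar>k i\<bar>))"
    have "f i x \<noteq> 0" using insert by simp
    then have "u > 0" using t by (auto simp: u_def intro!: divide_pos_pos)
    have "u * (1 + \<bar>k i\<bar>) \<le> \<bar>f i x\<bar>"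
      using min.cobounded2[of t "\<bar>f i x\<bar> / (1 + \<bar>k i\<bar>)"] unfolding u_def[symmetric]
      by (simp add: pos_le_divide_eq)
    then have "u * \<bar>k i\<bar> < \<bar>f i x\<bar>" using \<open>u > 0\<close> by (simp add: algebra_simps)
    moreover have "u * \<bar>k j\<bar> < \<bar>f j x\<bar>" if "j \<in> I" for j
      using t that mult_right_mono[of u t "\<bar>k j\<bar>"] by (force simp: u_def)
    ultimately show ?case using \<open>u > 0\<close> by auto
  qed
  then obtain t where t: "t > 0" "\<And>i. i \<in> I \<Longrightarrow> t * \<bar>k i\<bar> < \<bar>f i x\<bar>" by blast
  show thesis
  proof (rule that[OF t(1)])
    fix i s assume i: "i \<in> I" and s: "\<bar>s\<bar> = t"
    have "\<bar>s * k i\<bar> < \<bar>f i x\<bar>" using t(2)[OF i] s by (simp add: abs_mult)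
    then show "f i (x + s *\<^sub>R v) \<noteq> 0 \<and> (f i (x + s *\<^sub>R v) > 0 \<longleftrightarrow> f i x > 0)"
      unfolding lin[OF i] by linarith
  qed
qed

lemma segment_same_sign:
  fixes f :: "'v::real_vector \<Rightarrow> real"
  assumes "affine_fun f" "0 < t" "t < 1" "f x \<noteq> 0" "f y \<noteq> 0" "f x > 0 \<longleftrightarrow> f y > 0"
  shows "f (x + t *\<^sub>R (y - x)) \<noteq> 0 \<and> (f (x + t *\<^sub>R (y - x)) > 0 \<longleftrightarrow> f x > 0)"
proof -
  have eq: "f (x + t *\<^sub>R (y - x)) = (1 - t) * f x + t * f y"
    using affine_funD[OF assms(1), of x t y x] by (simp add: algebra_simps)
  show ?thesis
  proof (cases "f x > 0")
    case True
    then have "(1 - t) * f x > 0" "t * f y > 0" using assms by auto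
    then show ?thesis using True unfolding eq by linarith
  next
    case False
    then have "(1 - t) * f x < 0" "t * f y < 0" using assms by (auto intro!: mult_pos_neg)
    then show ?thesis using False unfolding eq by linarith
  qed
qed

text \<open>\<open>P\<close> and \<open>N\<close> collect the sign vectors over \<open>I\<close>
  realised where \<open>f h\<close> is positive and where it is negative. A chamber of
  \<open>I\<close> that \<open>h\<close> cuts occurs in both, any other in exactly one; so
  \<open>P \<union> N\<close> is the deletion, \<open>P \<inter> N\<close> the restriction, and
  \<open>card P + card N\<close> counts the chambers of \<open>insert h I\<close>.\<close>

lemma deletion_restriction:
  fixes f :: "'i \<Rightarrow> 'v::real_vector \<Rightarrow> real"
  assumes I: "finite I" "h \<notin> I" and aff: "\<And>i. i \<in> insert h I \<Longrightarrow> affine_fun (f i)"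
    and E: "affine E" and q: "q \<in> E" "f h q \<noteq> 0"
  shows "card (chambers E f (insert h I)) = card (chambers E f I) + card (chambers (zeros E f {h}) f I)"
proof -
  let ?\<sigma> = "\<lambda>x. {i \<in> I. f i x > 0}"
  define G where "G = {x \<in> E. \<forall>i\<in>I. f i x \<noteq> 0}"
  define P where "P = ?\<sigma> ` {x \<in> G. f h x > 0}"
  define N where "N = ?\<sigma> ` {x \<in> G. f h x < 0}"
  have fin: "finite P" "finite N"
    using I by (auto simp: P_def N_def intro: finite_subset[of _ "Pow I"])
  \<comment> \<open>A point on the zero set of \<open>f h\<close> can be moved off it to both sides,
    along the line through \<open>q\<close>, without changing its signs over
    \<open>I\<close>.\<close>
  have perturb: "?\<sigma> x \<in> P \<and> ?\<sigma> x \<in> N" if x: "x \<in> G" "f h x = 0" for x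
  proof -
    have *: "\<And>i. i \<in> I \<Longrightarrow> affine_fun (f i)" "\<And>i. i \<in> I \<Longrightarrow> f i x \<noteq> 0"
      using aff x by (auto simp: G_def)
    obtain t where t: "t > 0"
      "\<And>i s. i \<in> I \<Longrightarrow> \<bar>s\<bar> = t \<Longrightarrow>
        f i (x + s *\<^sub>R (q - x)) \<noteq> 0 \<and> (f i (x + s *\<^sub>R (q - x)) > 0 \<longleftrightarrow> f i x > 0)"
      using perturb_same_chamber[where f = f and x = x and v = "q - x", OF I(1) *] by blast
    have val: "f h (x + s *\<^sub>R (q - x)) = s * f h q" for s
      using affine_funD[OF aff, of h x s q x] x by simp
    have G: "x + s *\<^sub>R (q - x) \<in> G \<and> ?\<sigma> (x + s *\<^sub>R (q - x)) = ?\<sigma> x" if "\<bar>s\<bar> = t" for s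
      using t(2)[OF _ that] affine_line[OF E _ _ q(1), of x x s] x by (auto simp: G_def)
    define s where "s = (if f h q > 0 then t else - t)"
    have s: "\<bar>s\<bar> = t" "\<bar>- s\<bar> = t" "s * f h q > 0" "(- s) * f h q < 0"
      using t(1) q(2) by (auto simp: s_def zero_less_mult_iff mult_less_0_iff)
    have "f h (x + s *\<^sub>R (q - x)) > 0" "f h (x + (- s) *\<^sub>R (q - x)) < 0"
      using s(3,4) unfolding val .
    then have "?\<sigma> (x + s *\<^sub>R (q - x)) \<in> P" "?\<sigma> (x + (- s) *\<^sub>R (q - x)) \<in> N"
      using G[OF s(1)] G[OF s(2)] unfolding P_def N_def by blast+
    then show ?thesis using G[OF s(1)] G[OF s(2)] by simp
  qed
  have un: "P \<union> N = chambers E f I"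
  proof
    show "chambers E f I \<subseteq> P \<union> N"
    proof
      fix s assume "s \<in> chambers E f I"
      then obtain x where x: "x \<in> G" "s = ?\<sigma> x" by (auto simp: chambers_def G_def)
      then consider "f h x > 0" | "f h x < 0" | "f h x = 0" by linarith
      then show "s \<in> P \<union> N" using x perturb by cases (auto simp: P_def N_def)
    qed
  qed (auto simp: P_def N_def G_def chambers_def)
  have int: "P \<inter> N = chambers (zeros E f {h}) f I"
  proof
    show "chambers (zeros E f {h}) f I \<subseteq> P \<inter> N"
      using perturb by (auto simp: chambers_def zeros_def G_def)
    show "P \<inter> N \<subseteq> chambers (zeros E f {h}) f I"
    proof
      fix s assume "s \<in> P \<inter> N"
      then obtain x y where x: "x \<in> G" "f h x > 0" "s = ?\<sigma> x" and y: "y \<in> G" "f h y < 0" "s = ?\<sigma> y"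
        by (auto simp: P_def N_def)
      \<comment> \<open>The parameter at which \<open>f h\<close> vanishes on the segment from
        \<open>x\<close> to \<open>y\<close>.\<close>
      define t where "t = f h x / (f h x - f h y)"
      define z where "z = x + t *\<^sub>R (y - x)"
      have t: "0 < t" "t < 1" using x y by (auto simp: t_def divide_simps)
      have "f h z = f h x + t * (f h y - f h x)" unfolding z_def by (rule affine_funD[OF aff]) simp
      also have "\<dots> = 0" using x y by (simp add: t_def field_simps)
      finally have hz: "f h z = 0" .
      have zE: "z \<in> E" using x y affine_line[OF E] by (auto simp: z_def G_def)
      have "f i z \<noteq> 0 \<and> (f i z > 0 \<longleftrightarrow> f i x > 0)" if "i \<in> I" for i
        unfolding z_def using that x y t aff by (intro segment_same_sign) (auto simp: G_def)
      then have "s = ?\<sigma> z" "z \<in> {x \<in> zeros E f {h}. \<forall>i\<in>I. f i x \<noteq> 0}"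
        using x hz zE by (auto simp: zeros_def)
      then show "s \<in> chambers (zeros E f {h}) f I" unfolding chambers_def by blast
    qed
  qed
  have split: "chambers E f (insert h I) = insert h ` P \<union> N"
  proof -
    have "{i \<in> insert h I. f i x > 0} = (if f h x > 0 then insert h (?\<sigma> x) else ?\<sigma> x)" for x by auto
    then have "chambers E f (insert h I) =
        (\<lambda>x. if f h x > 0 then insert h (?\<sigma> x) else ?\<sigma> x) ` ({x \<in> G. f h x > 0} \<union> {x \<in> G. f h x < 0})"
      unfolding chambers_def by (intro image_cong) (auto simp: G_def)
    then show ?thesis unfolding image_Un P_def N_def image_image by (auto simp: image_iff)
  qed
  have hP: "h \<notin> s" if "s \<in> P \<union> N" for s using that I by (auto simp: P_def N_def)
  have "inj_on (insert h) P" using hP by (intro inj_onI) (metis UnI1 insert_ident)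
  then have "card (insert h ` P) = card P" by (rule card_image)
  moreover have "insert h ` P \<inter> N = {}" using hP by auto
  ultimately have "card (chambers E f (insert h I)) = card P + card N"
    unfolding split using fin by (simp add: card_Un_disjoint)
  then show ?thesis using card_Un_Int[OF fin] un int by simp
qed

section \<open>Whitney's sum and its recursion\<close>

lemma zeros_insert: "zeros E f (insert h S) = zeros (zeros E f {h}) f S"
  by (auto simp: zeros_def)

text \<open>The exponent has the parity of \<open>card S\<close> plus the codimension of the
  intersection in \<open>E\<close>; the two dimensions are added to avoid truncated
  subtraction.\<close>

definition whitney_sum :: "'v::real_vector set \<Rightarrow> ('i \<Rightarrow> 'v \<Rightarrow> real) \<Rightarrow> 'i set \<Rightarrow> int"
  where "whitney_sum E f I =
    (\<Sum>S\<in>Pow I. if zeros E f S = {} then 0 else (-1) ^ (card S + adim E + adim (zeros E f S)))"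

theorem card_chambers_whitney:
  fixes f :: "'i \<Rightarrow> 'v::real_vector \<Rightarrow> real"
  assumes "finite I" "\<And>i. i \<in> I \<Longrightarrow> affine_fun (f i)" "affine E" "finite B" "E \<subseteq> span B"
  shows "int (card (chambers E f I)) = whitney_sum E f I"
  using assms
proof (induction I arbitrary: E)
  case empty
  then show ?case
    by (cases "E = {}") (auto simp: chambers_def whitney_sum_def zeros_def image_constant_conv)
next
  case (insert h I)
  let ?E = "zeros E f {h}"
  have aff': "affine ?E" using insert.prems by (intro affine_zeros) auto
  have sub': "?E \<subseteq> span B" using insert.prems by (auto simp: zeros_def)
  have IH: "int (card (chambers E f I)) = whitney_sum E f I"
    "int (card (chambers ?E f I)) = whitney_sum ?E f I"
    using insert.IH insert.prems aff' sub' by auto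
  have cardS: "card (insert h S) = Suc (card S)" if "S \<subseteq> I" for S
    using that insert.hyps finite_subset by (metis card_insert_disjoint subset_iff)
  \<comment> \<open>Subsets of \<open>insert h I\<close> are split by whether they contain
    \<open>h\<close>; those that do correspond to subsets of \<open>I\<close> on the restriction
    \<open>?E\<close>, with one element more.\<close>
  have "whitney_sum E f (insert h I) = whitney_sum E f I +
      (\<Sum>S\<in>insert h ` Pow I. if zeros E f S = {} then 0 else (-1) ^ (card S + adim E + adim (zeros E f S)))"
    unfolding whitney_sum_def Pow_insert using insert.hyps by (intro sum.union_disjoint) auto
  also have "(\<Sum>S\<in>insert h ` Pow I. if zeros E f S = {} then 0 else (-1) ^ (card S + adim E + adim (zeros E f S)))
     = (\<Sum>S\<in>Pow I. if zeros ?E f S = {} then (0::int)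
          else (-1) ^ (Suc (card S) + adim E + adim (zeros ?E f S)))"
    using insert.hyps
    by (subst sum.reindex) (auto simp: inj_on_def cardS zeros_insert[symmetric] intro!: sum.cong)
  finally have rec: "whitney_sum E f (insert h I) = whitney_sum E f I + \<dots>" .
  show ?case
  proof (cases "\<exists>q\<in>E. f h q \<noteq> 0")
    case False
    \<comment> \<open>Here \<open>f h\<close> vanishes on all of \<open>E\<close>: there is no
      chamber, and the terms of \<open>S\<close> and \<open>insert h S\<close> cancel.\<close>
    then have "?E = E" by (auto simp: zeros_def)
    then have "whitney_sum E f (insert h I) = 0"
      unfolding rec unfolding whitney_sum_def sum.distrib[symmetric] by (intro sum.neutral) auto
    moreover have "chambers E f (insert h I) = {}" using False by (auto simp: chambers_def)
    ultimately show ?thesis by simp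
  next
    case True
    then obtain q where q: "q \<in> E" "f h q \<noteq> 0" by auto
    have dr: "int (card (chambers E f (insert h I))) = whitney_sum E f I + whitney_sum ?E f I"
      using deletion_restriction[of I h f E q] insert.hyps insert.prems q IH by simp
    \<comment> \<open>The dimension lost by restricting offsets the extra element \<open>h\<close>,
      so the second half of the sum is \<open>whitney_sum ?E f I\<close>. If \<open>?E\<close> is
      empty, all terms on both sides are \<open>0\<close>.\<close>
    have "adim E = Suc (adim ?E)" if ne: "?E \<noteq> {}"
    proof -
      obtain p where "p \<in> E" "f h p = 0" using ne unfolding zeros_def by blast
      then show ?thesis
        using adim_zeros_insert[OF \<open>affine E\<close> \<open>finite B\<close> \<open>E \<subseteq> span B\<close>, of "f h" p q] q insert.prems(1)
        by (simp add: zeros_def)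
    qed
    then have "whitney_sum ?E f I = (\<Sum>S\<in>Pow I. if zeros ?E f S = {} then (0::int)
          else (-1) ^ (Suc (card S) + adim E + adim (zeros ?E f S)))"
      unfolding whitney_sum_def
    proof (intro sum.cong refl if_cong)
      fix S assume *: "?E \<noteq> {} \<Longrightarrow> adim E = Suc (adim ?E)" "zeros ?E f S \<noteq> {}"
      then have "?E \<noteq> {}" by (auto simp: zeros_def)
      then show "(- 1) ^ (card S + adim ?E + adim (zeros ?E f S)) =
          (- 1::int) ^ (Suc (card S) + adim E + adim (zeros ?E f S))" using *(1) by simp
    qed
    then show ?thesis using dr rec by simp
  qed
qed

section \<open>Invariance under isomorphism of the posets of flats\<close>

lemma zeros_insert': "zeros E f (insert h S) = {x \<in> zeros E f S. f h x = 0}"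
  by (auto simp: zeros_def)

definition flats_in :: "'v set \<Rightarrow> 'v set set \<Rightarrow> 'v set set"
  where "flats_in E A = {X. X \<noteq> {} \<and> (\<exists>C\<subseteq>A. X = E \<inter> \<Inter>C)}"

text \<open>Each hyperplane indexes its own equation, so that \<open>A\<close> itself serves as
  index set in \<open>chambers E f A\<close>. Being nonempty and proper makes the hyperplanes
  recognisable among the flats.\<close>

locale hyperplanes =
  fixes E :: "'v::real_vector set" and A :: "'v set set" and f :: "'v set \<Rightarrow> 'v \<Rightarrow> real"
    and B :: "'v set"
  assumes affine_E: "affine E" and ne_E: "E \<noteq> {}"
    and finite_B: "finite B" and E_span: "E \<subseteq> span B" and finite_A: "finite A"
    and aff: "H \<in> A \<Longrightarrow> affine_fun (f H)"
    and H_eq: "H \<in> A \<Longrightarrow> H = {x \<in> E. f H x = 0}"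
    and H_ne: "H \<in> A \<Longrightarrow> H \<noteq> {}" and H_proper: "H \<in> A \<Longrightarrow> H \<noteq> E"
begin

lemma zeros_eq: "C \<subseteq> A \<Longrightarrow> zeros E f C = E \<inter> \<Inter>C"
  using H_eq by (fastforce simp: zeros_def)

lemma adim_zeros_step:
  assumes "C \<subseteq> A" "H \<in> A" "zeros E f (insert H C) \<noteq> {}"
  shows "zeros E f (insert H C) = zeros E f C \<or>
    adim (zeros E f C) = Suc (adim (zeros E f (insert H C)))"
proof (cases "\<exists>q\<in>zeros E f C. f H q \<noteq> 0")
  case True
  then obtain q where q: "q \<in> zeros E f C" "f H q \<noteq> 0" by auto
  obtain p where p: "p \<in> zeros E f C" "f H p = 0" using assms(3) by (auto simp: zeros_def)
  have "affine (zeros E f C)" using assms aff affine_E by (intro affine_zeros) auto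
  moreover have "zeros E f C \<subseteq> span B" using E_span by (auto simp: zeros_def)
  ultimately show ?thesis
    using adim_zeros_insert[OF _ finite_B _ aff[OF assms(2)] p q] by (simp add: zeros_insert')
qed (auto simp: zeros_insert')

text \<open>Together with \<open>adim_zeros_basis\<close> this makes the codimension of a flat the
  least number of hyperplanes cutting it out, a number that depends on intersections alone.\<close>

lemma adim_zeros_le:
  assumes "C \<subseteq> A" "zeros E f C \<noteq> {}"
  shows "adim E \<le> adim (zeros E f C) + card C"
proof -
  have "finite C" using assms finite_A finite_subset by blast
  then show ?thesis using assms
  proof (induction C)
    case empty
    then show ?case by (simp add: zeros_def)
  next
    case (insert H C)
    moreover have "zeros E f C \<noteq> {}" using insert.prems by (auto simp: zeros_def)
    moreover have "adim (zeros E f C) \<le> Suc (adim (zeros E f (insert H C)))"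
      using adim_zeros_step[of C H] insert.prems by auto
    ultimately show ?case by auto
  qed
qed

text \<open>Greedy choice: a hyperplane joins \<open>T\<close> only when it lowers the dimension of
  the intersection built so far.\<close>

lemma adim_zeros_basis:
  assumes "C \<subseteq> A" "zeros E f C \<noteq> {}"
  shows "\<exists>T\<subseteq>C. zeros E f T = zeros E f C \<and> adim E = adim (zeros E f C) + card T"
proof -
  have "finite C" using assms finite_A finite_subset by blast
  then show ?thesis using assms
  proof (induction C)
    case empty
    then show ?case by (simp add: zeros_def)
  next
    case (insert H C)
    have "zeros E f C \<noteq> {}" using insert.prems by (auto simp: zeros_def)
    then obtain T where T: "T \<subseteq> C" "zeros E f T = zeros E f C"
      "adim E = adim (zeros E f C) + card T"
      using insert by auto
    have "finite T" "H \<notin> T" using T insert.hyps finite_subset by auto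
    have "zeros E f (insert H T) = zeros E f (insert H C)" using T by (simp add: zeros_insert')
    from adim_zeros_step[of C H] insert.prems
    have "zeros E f (insert H C) = zeros E f C
      \<or> adim (zeros E f C) = Suc (adim (zeros E f (insert H C)))" by auto
    then show ?case
    proof (elim disjE)
      assume "zeros E f (insert H C) = zeros E f C"
      then show ?thesis using T by (intro exI[of _ T]) auto
    next
      assume "adim (zeros E f C) = Suc (adim (zeros E f (insert H C)))"
      then show ?thesis using T \<open>zeros E f (insert H T) = _\<close> \<open>finite T\<close> \<open>H \<notin> T\<close>
        by (intro exI[of _ "insert H T"]) auto
    qed
  qed
qed

lemma hyperplane_subset_eq:
  assumes "H \<in> A" "K \<in> A" "H \<subseteq> K"
  shows "H = K"
proof (rule ccontr)
  assume "H \<noteq> K"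
  then obtain x where x: "x \<in> K" "x \<notin> H" using assms by auto
  obtain p where p: "p \<in> H" using H_ne assms by auto
  have xE: "x \<in> E" "f K x = 0" "f H x \<noteq> 0" using x H_eq[OF assms(1)] H_eq[OF assms(2)] by auto
  have pE: "p \<in> E" "f K p = 0" "f H p = 0"
    using p assms(3) H_eq[OF assms(1)] H_eq[OF assms(2)] by auto
  have "f K y = 0" if y: "y \<in> E" for y
  proof -
    \<comment> \<open>\<open>x - p\<close> is a direction of \<open>K\<close> but not of
      \<open>H\<close>: moving \<open>y\<close> along it reaches \<open>H\<close>, hence
      \<open>K\<close>, while \<open>f K\<close> stays constant. So \<open>f K\<close> vanishes on
      all of \<open>E\<close>.\<close>
    define z where "z = y + (- (f H y / f H x)) *\<^sub>R (x - p)"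
    have "z \<in> E" unfolding z_def using affine_line[OF affine_E y pE(1) xE(1)] .
    moreover have "f H z = 0" unfolding z_def affine_funD[OF aff[OF assms(1)]] using xE pE by simp
    ultimately have "z \<in> K" using H_eq[OF assms(1)] assms(3) by auto
    then have "f K z = 0" using H_eq[OF assms(2)] by auto
    then show ?thesis unfolding z_def affine_funD[OF aff[OF assms(2)]] using xE pE by simp
  qed
  then have "K = E" using H_eq[OF assms(2)] by auto
  then show False using H_proper assms by auto
qed

lemma E_flat: "E \<in> flats_in E A"
  using ne_E by (auto simp: flats_in_def)

lemma flats_subset_E: "X \<in> flats_in E A \<Longrightarrow> X \<subseteq> E"
  by (auto simp: flats_in_def)

lemma A_flats: "A \<subseteq> flats_in E A"
proof
  fix H assume "H \<in> A"
  moreover from this have "H = E \<inter> \<Inter>{H}" using H_eq by auto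
  ultimately show "H \<in> flats_in E A" using H_ne unfolding flats_in_def by blast
qed

text \<open>This recovers the hyperplanes from the order alone, so an isomorphism of flats carries
  hyperplanes to hyperplanes. A flat other than \<open>E\<close> lies in some hyperplane, and no
  hyperplane properly contains another.\<close>

lemma A_eq_maximal_flats:
  "A = {X \<in> flats_in E A. X \<noteq> E \<and> (\<forall>Y\<in>flats_in E A. X \<subseteq> Y \<longrightarrow> Y = X \<or> Y = E)}"
  (is "A = ?M")
proof
  show "A \<subseteq> ?M"
  proof
    fix H assume H: "H \<in> A"
    have "Y = H \<or> Y = E" if Y: "Y \<in> flats_in E A" "H \<subseteq> Y" for Y
    proof (rule disjCI)
      assume "Y \<noteq> E"
      then obtain K where "K \<in> A" "Y \<subseteq> K" using Y by (fastforce simp: flats_in_def)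
      then show "Y = H" using hyperplane_subset_eq[OF H] Y by auto
    qed
    then show "H \<in> ?M" using H A_flats H_proper by blast
  qed
  show "?M \<subseteq> A"
  proof
    fix X assume X: "X \<in> ?M"
    then obtain K where K: "K \<in> A" "X \<subseteq> K" by (fastforce simp: flats_in_def)
    then show "X \<in> A" using X A_flats H_proper by blast
  qed
qed

end

section \<open>Transport of hyperplanes, intersections and codimension along an isomorphism\<close>

locale flats_iso =
  a1: hyperplanes E A f B + a2: hyperplanes E' A' f' B'
  for E :: "'v::real_vector set" and A f B and E' :: "'w::real_vector set" and A' f' B' +
  fixes g :: "'v set \<Rightarrow> 'w set"
  assumes bij: "bij_betw g (flats_in E A) (flats_in E' A')"
    and mono: "X \<in> flats_in E A \<Longrightarrow> Y \<in> flats_in E A \<Longrightarrow> g X \<subseteq> g Y \<longleftrightarrow> X \<subseteq> Y"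
begin

lemma g_flat: "X \<in> flats_in E A \<Longrightarrow> g X \<in> flats_in E' A'"
  using bij by (auto simp: bij_betw_def)

lemma g_eq_iff: "X \<in> flats_in E A \<Longrightarrow> Y \<in> flats_in E A \<Longrightarrow> g X = g Y \<longleftrightarrow> X = Y"
  using mono by (metis subset_antisym order_refl)

lemma g_E: "g E = E'"
proof -
  have "E' \<in> g ` flats_in E A" using bij_betw_imp_surj_on[OF bij] a2.E_flat by simp
  then obtain Y where Y: "Y \<in> flats_in E A" "E' = g Y" by (rule imageE)
  have "E' \<subseteq> g E" using mono[OF Y(1) a1.E_flat] a1.flats_subset_E[OF Y(1)] Y(2) by simp
  then show ?thesis using a2.flats_subset_E[OF g_flat[OF a1.E_flat]] by simp
qed

lemma g_A: "g ` A = A'"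
proof -
  have im: "flats_in E' A' = g ` flats_in E A" using bij by (simp add: bij_betw_def)
  have "A' = {X \<in> g ` flats_in E A. X \<noteq> g E \<and> (\<forall>Y\<in>g ` flats_in E A. X \<subseteq> Y \<longrightarrow> Y = X \<or> Y = g E)}"
    using a2.A_eq_maximal_flats unfolding im g_E .
  also have "\<dots> = g ` {X \<in> flats_in E A. X \<noteq> E \<and> (\<forall>Y\<in>flats_in E A. X \<subseteq> Y \<longrightarrow> Y = X \<or> Y = E)}"
    using mono g_eq_iff a1.E_flat by auto
  also have "\<dots> = g ` A" using a1.A_eq_maximal_flats by simp
  finally show ?thesis by simp
qed

text \<open>\<open>E \<inter> \<Inter>C\<close> is the largest flat contained in every member of
  \<open>C\<close>, and an order isomorphism preserves such infima. Nonemptiness transfers because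
  its image is again a flat, contained in all the images.\<close>

lemma g_Inter:
  assumes "C \<subseteq> A" "E \<inter> \<Inter>C \<noteq> {}"
  shows "E' \<inter> \<Inter>(g ` C) \<noteq> {} \<and> g (E \<inter> \<Inter>C) = E' \<inter> \<Inter>(g ` C)"
proof -
  let ?X = "E \<inter> \<Inter>C" let ?Y = "E' \<inter> \<Inter>(g ` C)"
  have X: "?X \<in> flats_in E A" using assms by (auto simp: flats_in_def)
  have CA: "H \<in> flats_in E A" if "H \<in> C" for H using that assms a1.A_flats by auto
  have "g ?X \<subseteq> g H" if "H \<in> C" for H using mono[OF X CA[OF that]] that by auto
  then have sub: "g ?X \<subseteq> ?Y" using a2.flats_subset_E[OF g_flat[OF X]] by blast
  have ne: "?Y \<noteq> {}" using sub g_flat[OF X] unfolding flats_in_def by blast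
  moreover have "g ` C \<subseteq> A'" using assms g_A by auto
  ultimately have "?Y \<in> flats_in E' A'" unfolding flats_in_def by blast
  then obtain Z where Z: "Z \<in> flats_in E A" "g Z = ?Y"
    using bij_betw_imp_surj_on[OF bij] by (metis imageE)
  have "Z \<subseteq> H" if "H \<in> C" for H using mono[OF Z(1) CA[OF that]] Z(2) that by auto
  then have "Z \<subseteq> ?X" using a1.flats_subset_E[OF Z(1)] by blast
  then have "?Y \<subseteq> g ?X" using mono[OF Z(1) X] Z by auto
  then show ?thesis using sub ne by auto
qed

text \<open>Codimension does not grow: a smallest family cutting out the flat is carried to a family
  cutting out its image. Equality follows by using the inverse isomorphism as well.\<close>

lemma adim_g_le:
  assumes "C \<subseteq> A" "E \<inter> \<Inter>C \<noteq> {}"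
  shows "adim E' + adim (E \<inter> \<Inter>C) \<le> adim E + adim (E' \<inter> \<Inter>(g ` C))"
proof -
  have "zeros E f C \<noteq> {}" using a1.zeros_eq assms by auto
  from a1.adim_zeros_basis[OF assms(1) this]
  obtain T where T: "T \<subseteq> C" "E \<inter> \<Inter>T = E \<inter> \<Inter>C" "adim E = adim (E \<inter> \<Inter>C) + card T"
    using a1.zeros_eq assms by (metis subset_trans)
  have TA: "T \<subseteq> A" using T assms by auto
  then have gT: "g ` T \<subseteq> A'" using g_A by auto
  have e: "E' \<inter> \<Inter>(g ` T) \<noteq> {}" "E' \<inter> \<Inter>(g ` T) = E' \<inter> \<Inter>(g ` C)"
    using g_Inter[OF assms] g_Inter[OF TA] assms T by auto
  have "card (g ` T) \<le> card T" using TA a1.finite_A finite_subset by (intro card_image_le) blast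
  then show ?thesis using a2.adim_zeros_le[OF gT] e T(3) a2.zeros_eq[OF gT] by auto
qed

end

text \<open>Sending \<open>C\<close> to its image under \<open>g\<close> matches the two Whitney
  sums term by term: emptiness, cardinality and codimension agree. The ambient dimensions may
  differ.\<close>

theorem card_chambers_flats_iso:
  assumes a1: "hyperplanes E A f B" and a2: "hyperplanes E' A' f' B'"
    and iso: "rev_incl_iso (flats_in E A) (flats_in E' A')"
  shows "card (chambers E f A) = card (chambers E' f' A')"
proof -
  interpret a1: hyperplanes E A f B by fact
  interpret a2: hyperplanes E' A' f' B' by fact
  obtain g where g: "bij_betw g (flats_in E A) (flats_in E' A')"
    "\<And>X Y. X \<in> flats_in E A \<Longrightarrow> Y \<in> flats_in E A \<Longrightarrow> g X \<subseteq> g Y \<longleftrightarrow> X \<subseteq> Y"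
    using iso unfolding rev_incl_iso_def by auto
  interpret fg: flats_iso E A f B E' A' f' B' g by unfold_locales (use g in auto)
  define h where "h = inv_into (flats_in E A) g"
  have h: "bij_betw h (flats_in E' A') (flats_in E A)" using g(1) by (simp add: h_def bij_betw_inv_into)
  have gh: "g (h X) = X" if "X \<in> flats_in E' A'" for X
    using g(1) that by (simp add: h_def bij_betw_inv_into_right)
  have hg: "h (g X) = X" if "X \<in> flats_in E A" for X
    using g(1) that by (simp add: h_def bij_betw_inv_into_left)
  have hf: "h X \<in> flats_in E A" if "X \<in> flats_in E' A'" for X
    using h that by (auto simp: bij_betw_def)
  have hmono: "h X \<subseteq> h Y \<longleftrightarrow> X \<subseteq> Y" if "X \<in> flats_in E' A'" "Y \<in> flats_in E' A'" for X Y
    using g(2)[OF hf hf, OF that] gh that by simp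
  interpret fh: flats_iso E' A' f' B' E A f B h
    by unfold_locales (fact h hmono)+
  have hgC: "h ` g ` C = C" if "C \<subseteq> A" for C
  proof -
    have "h (g X) = X" if "X \<in> C" for X using hg a1.A_flats that \<open>C \<subseteq> A\<close> by blast
    then show ?thesis by (simp add: image_image)
  qed
  have inj: "inj_on g A"
    using bij_betw_imp_inj_on[OF g(1)] a1.A_flats by (rule inj_on_subset)
  have bijP: "bij_betw (image g) (Pow A) (Pow A')"
    using inj fg.g_A by (intro bij_betw_Pow) (simp add: bij_betw_def)
  have term_eq: "(if zeros E' f' (g ` C) = {} then 0
      else (-1::int) ^ (card (g ` C) + adim E' + adim (zeros E' f' (g ` C)))) =
      (if zeros E f C = {} then 0 else (-1) ^ (card C + adim E + adim (zeros E f C)))"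
    if C: "C \<in> Pow A" for C
  proof -
    have CA: "C \<subseteq> A" "g ` C \<subseteq> A'" using C fg.g_A by auto
    have z: "zeros E f C = E \<inter> \<Inter>C" "zeros E' f' (g ` C) = E' \<inter> \<Inter>(g ` C)"
      using a1.zeros_eq a2.zeros_eq CA by auto
    have ne: "E \<inter> \<Inter>C \<noteq> {} \<longleftrightarrow> E' \<inter> \<Inter>(g ` C) \<noteq> {}"
      using fg.g_Inter[OF CA(1)] fh.g_Inter[OF CA(2)] hgC[OF CA(1)] by auto
    have c: "card (g ` C) = card C" using inj CA by (meson card_image inj_on_subset)
    show ?thesis
    proof (cases "E \<inter> \<Inter>C = {}")
      case False
      \<comment> \<open>One inequality comes from \<open>g\<close>, the other from its inverse
        \<open>h\<close>; equal codimensions then give exponents of equal parity.\<close>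
      have "adim E' + adim (E \<inter> \<Inter>C) = adim E + adim (E' \<inter> \<Inter>(g ` C))"
        using fg.adim_g_le[OF CA(1) False] fh.adim_g_le[OF CA(2)] False ne hgC[OF CA(1)] by simp
      moreover have "a' + x = a + y \<Longrightarrow> even (a' + y) \<longleftrightarrow> even (a + x)" for a a' x y :: nat
        by presburger
      ultimately have "even (adim E' + adim (E' \<inter> \<Inter>(g ` C))) \<longleftrightarrow> even (adim E + adim (E \<inter> \<Inter>C))"
        by blast
      then show ?thesis using False ne unfolding z c add.assoc by (simp add: minus_one_power_iff)
    qed (use ne z in auto)
  qed
  have "whitney_sum E' f' A' = whitney_sum E f A"
    unfolding whitney_sum_def sum.reindex_bij_betw[OF bijP, symmetric]
    using term_eq by (rule sum.cong[OF refl])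
  moreover have "int (card (chambers E f A)) = whitney_sum E f A"
    using a1.finite_A a1.aff a1.affine_E a1.finite_B a1.E_span by (rule card_chambers_whitney)
  moreover have "int (card (chambers E' f' A')) = whitney_sum E' f' A'"
    using a2.finite_A a2.aff a2.affine_E a2.finite_B a2.E_span by (rule card_chambers_whitney)
  ultimately show ?thesis by simp
qed

section \<open>Patterns of difference arrangements\<close>

text \<open>Distinct members of a finite chain have distinct ranks, so the ranks fill
  \<open>{1..card C}\<close>; a member counts itself, hence \<open>Suc k\<close>. This finds the
  ideal at which a pattern is cut.\<close>

lemma finite_chain_rank:
  assumes "finite C" and chain: "\<And>X Y. X \<in> C \<Longrightarrow> Y \<in> C \<Longrightarrow> X \<subseteq> Y \<or> Y \<subseteq> X"
    and "k < card C"
  shows "\<exists>T\<in>C. card {X \<in> C. X \<subseteq> T} = Suc k"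
proof -
  let ?r = "\<lambda>T. card {X \<in> C. X \<subseteq> T}"
  have "T = U" if TU: "T \<in> C" "U \<in> C" "?r T = ?r U" "T \<subseteq> U" for T U
  proof -
    have "{X \<in> C. X \<subseteq> T} = {X \<in> C. X \<subseteq> U}"
      using TU \<open>finite C\<close> by (intro card_subset_eq) auto
    then have "U \<in> {X \<in> C. X \<subseteq> T}" using TU(2) by simp
    then show ?thesis using TU(4) by simp
  qed
  note eq = this
  have "inj_on ?r C"
  proof (rule inj_onI)
    fix T U assume "T \<in> C" "U \<in> C" "?r T = ?r U"
    then show "T = U" using chain[of T U] eq[of T U] eq[of U T] by auto
  qed
  then have "card (?r ` C) = card C" by (rule card_image)
  moreover have "?r ` C \<subseteq> {1..card C}"
  proof
    fix m assume "m \<in> ?r ` C"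
    then obtain T where "T \<in> C" "m = ?r T" by auto
    moreover from this have "{X \<in> C. X \<subseteq> T} \<noteq> {}" by auto
    ultimately show "m \<in> {1..card C}"
      using \<open>finite C\<close> by (auto simp: Suc_le_eq card_gt_0_iff intro: card_mono)
  qed
  ultimately have "?r ` C = {1..card C}" by (intro card_subset_eq) auto
  moreover have "Suc k \<in> {1..card C}" using assms(3) by simp
  ultimately have "Suc k \<in> ?r ` C" by simp
  then show ?thesis by force
qed

definition generic :: "('v \<Rightarrow> 'v \<Rightarrow> real set) \<Rightarrow> 'v set \<Rightarrow> ('v \<Rightarrow> real) \<Rightarrow> bool"
  where "generic D S x \<longleftrightarrow> (\<forall>i\<in>S. \<forall>j\<in>S. i \<noteq> j \<longrightarrow> x i - x j \<notin> D i j)"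

definition pattern :: "('v \<Rightarrow> 'v \<Rightarrow> real set) \<Rightarrow> 'v set \<Rightarrow> ('v \<Rightarrow> real) \<Rightarrow> ('v \<times> 'v \<times> real) set"
  where "pattern D S x = {(i, j, a). i \<in> S \<and> j \<in> S \<and> i \<noteq> j \<and> a \<in> D i j \<and> x i - x j < a}"

text \<open>Only the coordinates in \<open>S\<close> matter, so \<open>x\<close> ranges over all
  functions, and subsets can be treated without an ambient dimension.\<close>

definition patterns :: "('v \<Rightarrow> 'v \<Rightarrow> real set) \<Rightarrow> 'v set \<Rightarrow> ('v \<times> 'v \<times> real) set set"
  where "patterns D S = pattern D S ` {x. generic D S x}"

text \<open>An entry \<open>(i, j, a)\<close> of a pattern is read as an arc from \<open>i\<close> to \<open>j\<close>: it forces
  \<open>v i \<le> v j\<close> on the recession cone. Hence the ideals are the initial segments of the ordered set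
  partition (into strong components) whose braid cone is the recession cone, and a region of level
  \<open>l\<close> has \<open>l + 1\<close> of them.\<close>

definition ideals :: "'v set \<Rightarrow> ('v \<times> 'v \<times> real) set \<Rightarrow> 'v set set"
  where "ideals S P = {T. T \<subseteq> S \<and> (\<forall>i\<in>T. \<forall>j\<in>S - T. \<forall>a. (j, i, a) \<notin> P)}"

definition pattern_count :: "('v \<Rightarrow> 'v \<Rightarrow> real set) \<Rightarrow> 'v set \<Rightarrow> nat \<Rightarrow> nat"
  where "pattern_count D S l = card {P \<in> patterns D S. card (ideals S P) = Suc l}"

definition restrict_pattern :: "'v set \<Rightarrow> ('v \<times> 'v \<times> real) set \<Rightarrow> ('v \<times> 'v \<times> real) set"
  where "restrict_pattern T P = {(i, j, a) \<in> P. i \<in> T \<and> j \<in> T}"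

definition glue :: "('v \<Rightarrow> 'v \<Rightarrow> real set) \<Rightarrow> 'v set \<Rightarrow> 'v set \<Rightarrow>
    ('v \<times> 'v \<times> real) set \<Rightarrow> ('v \<times> 'v \<times> real) set \<Rightarrow> ('v \<times> 'v \<times> real) set"
  where "glue D T U P Q = P \<union> Q \<union> {(i, j, a). i \<in> T \<and> j \<in> U \<and> a \<in> D i j}"

lemma generic_subset: "generic D S x \<Longrightarrow> T \<subseteq> S \<Longrightarrow> generic D T x"
  by (auto simp: generic_def)

lemma restrict_pattern_pattern: "T \<subseteq> S \<Longrightarrow> restrict_pattern T (pattern D S x) = pattern D T x"
  by (auto simp: restrict_pattern_def pattern_def)

lemma restrict_pattern_in_patterns:
  "P \<in> patterns D S \<Longrightarrow> T \<subseteq> S \<Longrightarrow> restrict_pattern T P \<in> patterns D T"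
  by (auto simp: patterns_def restrict_pattern_pattern intro: generic_subset)

section \<open>Ideals of a pattern and of its restrictions\<close>

lemma finite_ideals: "finite S \<Longrightarrow> finite (ideals S P)"
  by (rule finite_subset[of _ "Pow S"]) (auto simp: ideals_def)

lemma empty_ideal: "{} \<in> ideals S P" and full_ideal: "S \<in> ideals S P"
  by (auto simp: ideals_def)

lemma ideals_restrict_below:
  assumes "T \<in> ideals S P"
  shows "ideals T (restrict_pattern T P) = {X \<in> ideals S P. X \<subseteq> T}"
  using assms by (fastforce simp: ideals_def restrict_pattern_def)

text \<open>Adding and removing \<open>T\<close> are inverse to each other; the union is again an
  ideal because no arc enters \<open>T\<close> from outside.\<close>

lemma card_ideals_restrict_above:
  assumes T: "T \<in> ideals S P"
  shows "card (ideals (S - T) (restrict_pattern (S - T) P)) = card {X \<in> ideals S P. T \<subseteq> X}"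
proof -
  have "bij_betw (\<lambda>X. X \<union> T) (ideals (S - T) (restrict_pattern (S - T) P)) {X \<in> ideals S P. T \<subseteq> X}"
  proof (rule bij_betw_byWitness[where f' = "\<lambda>X. X - T"])
    show "(\<lambda>X. X \<union> T) ` ideals (S - T) (restrict_pattern (S - T) P) \<subseteq> {X \<in> ideals S P. T \<subseteq> X}"
      using T by (fastforce simp: ideals_def restrict_pattern_def)
  qed (auto simp: ideals_def restrict_pattern_def)
  then show ?thesis by (rule bij_betw_same_card)
qed

text \<open>\<open>D_sym\<close> reflects that \<open>x i - x j = a\<close> and
  \<open>x j - x i = - a\<close> describe the same hyperplane. \<open>D_ne\<close> joins any two
  vertices by an arc, which makes the ideals a chain.\<close>

locale differences =
  fixes S0 :: "'v set" and D :: "'v \<Rightarrow> 'v \<Rightarrow> real set"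
  assumes finite_S0: "finite S0"
    and finite_D: "\<lbrakk>i \<in> S0; j \<in> S0; i \<noteq> j\<rbrakk> \<Longrightarrow> finite (D i j)"
    and D_ne: "\<lbrakk>i \<in> S0; j \<in> S0; i \<noteq> j\<rbrakk> \<Longrightarrow> D i j \<noteq> {}"
    and D_sym: "\<lbrakk>i \<in> S0; j \<in> S0; i \<noteq> j\<rbrakk> \<Longrightarrow> a \<in> D i j \<Longrightarrow> - a \<in> D j i"
begin

lemma finite_sub: "S \<subseteq> S0 \<Longrightarrow> finite S"
  using finite_S0 finite_subset by blast

lemma finite_patterns:
  assumes "S \<subseteq> S0" shows "finite (patterns D S)"
proof (rule finite_subset)
  let ?K = "\<Union>i\<in>S. \<Union>j\<in>S - {i}. (\<lambda>a. (i, j, a)) ` D i j"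
  show "patterns D S \<subseteq> Pow ?K" by (auto simp: patterns_def pattern_def)
  show "finite (Pow ?K)"
    using assms finite_sub[OF assms] by (auto intro!: finite_imageI finite_D)
qed

text \<open>A generic point lies strictly on one side of each hyperplane, and the two orientations
  of the hyperplane record opposite sides.\<close>

lemma arc_or_reverse:
  assumes "S \<subseteq> S0" "generic D S x" "i \<in> S" "j \<in> S" "i \<noteq> j" "a \<in> D i j"
  shows "(i, j, a) \<in> pattern D S x \<longleftrightarrow> (j, i, - a) \<notin> pattern D S x"
proof -
  have "x i - x j \<noteq> a" using assms by (auto simp: generic_def)
  moreover have "- a \<in> D j i" using D_sym assms by blast
  ultimately show ?thesis using assms by (auto simp: pattern_def)
qed

text \<open>For \<open>i\<close> in \<open>T - U\<close> and \<open>j\<close> in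
  \<open>U - T\<close>, any offset yields an arc one way or the other, and this arc enters
  \<open>U\<close> or \<open>T\<close> from outside.\<close>

lemma ideals_chain:
  assumes "S \<subseteq> S0" "P \<in> patterns D S" "T \<in> ideals S P" "U \<in> ideals S P"
  shows "T \<subseteq> U \<or> U \<subseteq> T"
proof (rule ccontr)
  assume "\<not> ?thesis"
  then obtain i j where ij: "i \<in> T" "i \<notin> U" "j \<in> U" "j \<notin> T" by auto
  have S: "i \<in> S" "j \<in> S" using ij assms by (auto simp: ideals_def)
  then obtain a where a: "a \<in> D i j" using D_ne[of i j] assms ij by blast
  obtain x where x: "generic D S x" "P = pattern D S x" using assms by (auto simp: patterns_def)
  have "i \<noteq> j" using ij by auto
  then have "(i, j, a) \<in> P \<or> (j, i, - a) \<in> P" using arc_or_reverse[OF assms(1) x(1) S _ a] x by auto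
  moreover have "(j, i, - a) \<notin> P" using assms(3) ij S by (auto simp: ideals_def)
  moreover have "(i, j, a) \<notin> P" using assms(4) ij S by (auto simp: ideals_def)
  ultimately show False by blast
qed

text \<open>By the chain property every ideal lies below or above \<open>T\<close>, and only
  \<open>T\<close> does both, hence the \<open>Suc\<close>. As level \<open>l\<close> means
  \<open>l + 1\<close> ideals, levels add under cutting.\<close>

lemma card_ideals_split:
  assumes "S \<subseteq> S0" "P \<in> patterns D S" "T \<in> ideals S P"
  shows "Suc (card (ideals S P)) =
    card (ideals T (restrict_pattern T P)) + card (ideals (S - T) (restrict_pattern (S - T) P))"
proof -
  let ?A = "{X \<in> ideals S P. X \<subseteq> T}" and ?B = "{X \<in> ideals S P. T \<subseteq> X}"
  have fin: "finite ?A" "finite ?B" using finite_ideals[OF finite_sub[OF assms(1)]] by auto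
  have "?A \<union> ?B = ideals S P" using ideals_chain[OF assms] by blast
  moreover have "?A \<inter> ?B = {T}" using assms(3) by auto
  ultimately show ?thesis
    using card_Un_Int[OF fin] ideals_restrict_below[OF assms(3)] card_ideals_restrict_above[OF assms(3)]
    by simp
qed

text \<open>Moving the \<open>U\<close>-coordinates far up relative to the \<open>T\<close>-coordinates realises all arcs from
  \<open>T\<close> to \<open>U\<close>.\<close>

lemma glue_pattern:
  assumes TU: "T \<subseteq> S0" "U \<subseteq> S0" "T \<inter> U = {}" and P: "P \<in> patterns D T" and Q: "Q \<in> patterns D U"
  shows "glue D T U P Q \<in> patterns D (T \<union> U)"
    and "T \<in> ideals (T \<union> U) (glue D T U P Q)"
    and "restrict_pattern T (glue D T U P Q) = P"
    and "restrict_pattern U (glue D T U P Q) = Q"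
proof -
  obtain x where x: "generic D T x" "P = pattern D T x" using P by (auto simp: patterns_def)
  obtain y where y: "generic D U y" "Q = pattern D U y" using Q by (auto simp: patterns_def)
  \<comment> \<open>The inequalities \<open>x i - (y j + M) < a\<close> for all cross offsets say
    that \<open>M\<close> exceeds every element of \<open>K\<close>.\<close>
  define K where "K = (\<Union>i\<in>T. \<Union>j\<in>U. (\<lambda>a. x i - y j - a) ` D i j)"
  have ne: "i \<noteq> j" if "i \<in> T" "j \<in> U" for i j using that TU by auto
  have "finite K"
    unfolding K_def using TU ne finite_sub by (intro finite_UN_I finite_imageI finite_D) auto
  obtain M where M: "\<And>k. k \<in> K \<Longrightarrow> k < M"
    using finite_has_maximal[of "insert 0 K"] \<open>finite K\<close>
    by (metis Max_ge finite_insert insertCI less_add_one order_le_less_trans)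
  define z where "z k = (if k \<in> T then x k else y k + M)" for k
  have z: "k \<in> T \<Longrightarrow> z k = x k" "k \<in> U \<Longrightarrow> z k = y k + M" for k using TU by (auto simp: z_def)
  have TU_lt: "z i - z j < a" if "i \<in> T" "j \<in> U" "a \<in> D i j" for i j a
    using M[of "x i - y j - a"] that z by (force simp: K_def)
  have UT_gt: "z j - z i > a" if ij: "i \<in> T" "j \<in> U" "a \<in> D j i" for i j a
  proof -
    have "- a \<in> D i j" using D_sym[of j i a] ij TU ne by blast
    then show ?thesis using TU_lt[OF ij(1,2)] by fastforce
  qed
  have gen: "generic D (T \<union> U) z"
    unfolding generic_def
  proof (intro ballI impI)
    fix i j assume ij: "i \<in> T \<union> U" "j \<in> T \<union> U" "i \<noteq> j"
    then consider "i \<in> T" "j \<in> T" | "i \<in> U" "j \<in> U" | "i \<in> T" "j \<in> U" | "i \<in> U" "j \<in> T" by auto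
    then show "z i - z j \<notin> D i j"
      using x(1) y(1) z TU_lt[of i j "z i - z j"] UT_gt[of j i "z i - z j"] ij
      by cases (auto simp: generic_def)
  qed
  have eq: "glue D T U P Q = pattern D (T \<union> U) z"
  proof (rule set_eqI, clarify)
    fix i j a
    show "(i, j, a) \<in> glue D T U P Q \<longleftrightarrow> (i, j, a) \<in> pattern D (T \<union> U) z"
    proof (cases "i \<in> T \<union> U \<and> j \<in> T \<union> U")
      case True
      then consider "i \<in> T" "j \<in> T" | "i \<in> U" "j \<in> U" | "i \<in> T" "j \<in> U" | "i \<in> U" "j \<in> T" by auto
      then show ?thesis
        using x(2) y(2) z TU_lt[of i j a] UT_gt[of j i a] TU(3) ne
        by cases (auto simp: glue_def pattern_def)
    qed (use x(2) y(2) in \<open>auto simp: glue_def pattern_def\<close>)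
  qed
  show "glue D T U P Q \<in> patterns D (T \<union> U)" unfolding eq using gen by (auto simp: patterns_def)
  show "T \<in> ideals (T \<union> U) (glue D T U P Q)"
    using TU x(2) y(2) by (auto simp: ideals_def glue_def pattern_def)
  show "restrict_pattern T (glue D T U P Q) = P" "restrict_pattern U (glue D T U P Q) = Q"
    using TU x(2) y(2) by (auto simp: restrict_pattern_def glue_def pattern_def)
qed

text \<open>No arc enters the ideal \<open>T\<close> from outside, so by
  \<open>arc_or_reverse\<close> every possible arc leaving \<open>T\<close> is present: the cross
  part of \<open>P\<close> is forced.\<close>

lemma glue_restrict:
  assumes S: "S \<subseteq> S0" and P: "P \<in> patterns D S" and T: "T \<in> ideals S P"
  shows "glue D T (S - T) (restrict_pattern T P) (restrict_pattern (S - T) P) = P"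
proof -
  obtain x where x: "generic D S x" "P = pattern D S x" using P by (auto simp: patterns_def)
  have TS: "T \<subseteq> S" using T by (auto simp: ideals_def)
  have cross: "(i, j, a) \<in> P" if "i \<in> T" "j \<in> S - T" "a \<in> D i j" for i j a
    using arc_or_reverse[OF S x(1), of i j a] that T TS x(2) by (auto simp: ideals_def)
  have no: "(j, i, a) \<notin> P" if "i \<in> T" "j \<in> S - T" for i j a
    using T that by (auto simp: ideals_def)
  have PS: "i \<in> S \<and> j \<in> S \<and> a \<in> D i j" if "(i, j, a) \<in> P" for i j a
    using that x by (auto simp: pattern_def)
  show ?thesis
  proof (rule set_eqI, clarify)
    fix i j a
    show "(i, j, a) \<in> glue D T (S - T) (restrict_pattern T P) (restrict_pattern (S - T) P)
        \<longleftrightarrow> (i, j, a) \<in> P"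
      using cross[of i j a] no[of j i a] PS[of i j a] by (auto simp: glue_def restrict_pattern_def)
  qed
qed

text \<open>The rank along the chain of ideals singles out one ideal \<open>T\<close> with
  \<open>Suc k\<close> ideals inside it, itself included. Cutting at \<open>T\<close> and gluing are
  mutually inverse, so the patterns cut at \<open>T\<close> number the product of the two
  counts.\<close>

theorem pattern_count_add:
  assumes S: "S \<subseteq> S0"
  shows "pattern_count D S (k + l) = (\<Sum>T\<in>Pow S. pattern_count D T k * pattern_count D (S - T) l)"
proof -
  define K where "K T = {P \<in> patterns D S. T \<in> ideals S P \<and>
    card (ideals T (restrict_pattern T P)) = Suc k \<and>
    card (ideals (S - T) (restrict_pattern (S - T) P)) = Suc l}" for T
  have finS: "finite S" using finite_sub[OF S] .
  have union: "{P \<in> patterns D S. card (ideals S P) = Suc (k + l)} = (\<Union>T\<in>Pow S. K T)"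
  proof
    show "(\<Union>T\<in>Pow S. K T) \<subseteq> {P \<in> patterns D S. card (ideals S P) = Suc (k + l)}"
      using card_ideals_split[OF S] by (fastforce simp: K_def)
    show "{P \<in> patterns D S. card (ideals S P) = Suc (k + l)} \<subseteq> (\<Union>T\<in>Pow S. K T)"
    proof
      fix P assume "P \<in> {P \<in> patterns D S. card (ideals S P) = Suc (k + l)}"
      then have P: "P \<in> patterns D S" "card (ideals S P) = Suc (k + l)" by auto
      have "\<exists>T\<in>ideals S P. card {X \<in> ideals S P. X \<subseteq> T} = Suc k"
        using ideals_chain[OF S P(1)] P(2) by (intro finite_chain_rank finite_ideals finS) auto
      then obtain T where T: "T \<in> ideals S P" "card {X \<in> ideals S P. X \<subseteq> T} = Suc k"
        by blast
      then have "card (ideals T (restrict_pattern T P)) = Suc k" using ideals_restrict_below by metis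
      then have "P \<in> K T" using card_ideals_split[OF S P(1) T(1)] P T by (auto simp: K_def)
      then show "P \<in> (\<Union>T\<in>Pow S. K T)" using T by (auto simp: ideals_def)
    qed
  qed
  \<comment> \<open>Two cutting ideals of one pattern have the same rank, hence coincide; so the
    sets \<open>K T\<close> are disjoint.\<close>
  have less: "T = U" if "P \<in> K T" "P \<in> K U" "T \<subseteq> U" for P T U
  proof -
    have TU: "T \<in> ideals S P" "U \<in> ideals S P" using that by (auto simp: K_def)
    have "{X \<in> ideals S P. X \<subseteq> T} = {X \<in> ideals S P. X \<subseteq> U}"
      using that finite_ideals[OF finS] ideals_restrict_below[OF TU(1)] ideals_restrict_below[OF TU(2)]
      by (intro card_subset_eq) (auto simp: K_def)
    then show ?thesis using TU that by blast
  qed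
  have disj: "K T \<inter> K U = {}" if "T \<noteq> U" for T U
  proof (rule ccontr)
    assume "K T \<inter> K U \<noteq> {}"
    then obtain P where P: "P \<in> K T" "P \<in> K U" by auto
    then have "T \<subseteq> U \<or> U \<subseteq> T" using ideals_chain[OF S] by (auto simp: K_def)
    then show False using less P that by blast
  qed
  have card_K: "card (K T) = pattern_count D T k * pattern_count D (S - T) l" if "T \<in> Pow S" for T
  proof -
    let ?A = "{P \<in> patterns D T. card (ideals T P) = Suc k}"
    let ?B = "{P \<in> patterns D (S - T). card (ideals (S - T) P) = Suc l}"
    have TS: "T \<union> (S - T) = S" "T \<subseteq> S0" "S - T \<subseteq> S0" "T \<inter> (S - T) = {}" using that S by auto
    note gl = glue_pattern[OF TS(2-4), unfolded TS(1)]
    have "bij_betw (\<lambda>P. (restrict_pattern T P, restrict_pattern (S - T) P)) (K T) (?A \<times> ?B)"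
    proof (rule bij_betw_byWitness[where f' = "\<lambda>(P, Q). glue D T (S - T) P Q"])
      show "\<forall>P\<in>K T. (case (restrict_pattern T P, restrict_pattern (S - T) P) of
          (P, Q) \<Rightarrow> glue D T (S - T) P Q) = P"
        using glue_restrict[OF S] by (auto simp: K_def)
      show "\<forall>PQ\<in>?A \<times> ?B. (restrict_pattern T (case PQ of (P, Q) \<Rightarrow> glue D T (S - T) P Q),
          restrict_pattern (S - T) (case PQ of (P, Q) \<Rightarrow> glue D T (S - T) P Q)) = PQ"
        using gl(3,4) by auto
      show "(\<lambda>P. (restrict_pattern T P, restrict_pattern (S - T) P)) ` K T \<subseteq> ?A \<times> ?B"
        using that by (auto simp: K_def intro: restrict_pattern_in_patterns)
      show "(\<lambda>(P, Q). glue D T (S - T) P Q) ` (?A \<times> ?B) \<subseteq> K T"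
        using gl by (auto simp: K_def)
    qed
    then have "card (K T) = card (?A \<times> ?B)" by (rule bij_betw_same_card)
    then show ?thesis by (simp add: pattern_count_def card_cartesian_product)
  qed
  have "finite (K T)" for T using finite_patterns[OF S] by (simp add: K_def)
  then have "card (\<Union>T\<in>Pow S. K T) = (\<Sum>T\<in>Pow S. card (K T))"
    using finS disj by (intro card_UN_disjoint) auto
  then show ?thesis unfolding pattern_count_def[of D S] union using card_K by simp
qed

text \<open>Cardinality is injective on a chain of finite sets and takes values in
  \<open>{..card S}\<close>. This bounds the levels by \<open>card S\<close>.\<close>

lemma card_ideals_le:
  assumes S: "S \<subseteq> S0" and P: "P \<in> patterns D S"
  shows "card (ideals S P) \<le> Suc (card S)"
proof -
  have fin: "finite S" using finite_sub[OF S] .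
  have *: "X \<subseteq> S" if "X \<in> ideals S P" for X using that by (auto simp: ideals_def)
  have "inj_on card (ideals S P)"
  proof (rule inj_onI)
    fix X Y assume XY: "X \<in> ideals S P" "Y \<in> ideals S P" "card X = card Y"
    have "finite X" "finite Y" using XY * fin finite_subset by blast+
    then show "X = Y" using ideals_chain[OF S P XY(1,2)] XY(3) card_subset_eq by metis
  qed
  then have "card (ideals S P) = card (card ` ideals S P)" by (rule card_image[symmetric])
  also have "\<dots> \<le> card {..card S}" using * fin by (intro card_mono) (auto intro: card_mono)
  finally show ?thesis by simp
qed

lemma card_patterns_eq_sum:
  assumes S: "S \<subseteq> S0"
  shows "card (patterns D S) = (\<Sum>l\<le>card S. pattern_count D S l)"
proof -
  have "patterns D S = (\<Union>l\<le>card S. {P \<in> patterns D S. card (ideals S P) = Suc l})"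
  proof
    show "patterns D S \<subseteq> (\<Union>l\<le>card S. {P \<in> patterns D S. card (ideals S P) = Suc l})"
    proof
      fix P assume P: "P \<in> patterns D S"
      have "ideals S P \<noteq> {}" using empty_ideal by blast
      then have "card (ideals S P) \<noteq> 0" using finite_ideals[OF finite_sub[OF S]] by simp
      then obtain l where "card (ideals S P) = Suc l" using not0_implies_Suc by blast
      then show "P \<in> (\<Union>l\<le>card S. {P \<in> patterns D S. card (ideals S P) = Suc l})"
        using card_ideals_le[OF S P] P by auto
    qed
  qed auto
  also have "card \<dots> = (\<Sum>l\<le>card S. pattern_count D S l)"
    unfolding pattern_count_def using finite_patterns[OF S] by (intro card_UN_disjoint) auto
  finally show ?thesis .
qed

end

lemma ideals_empty: "ideals {} P = {{}}"
  by (auto simp: ideals_def)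

lemma pattern_count_empty: "pattern_count D {} l = (if l = 0 then 1 else 0)"
proof -
  have "patterns D {} = {{}}" by (auto simp: patterns_def pattern_def generic_def)
  then have "{P \<in> patterns D {}. card (ideals {} P) = Suc l} = (if l = 0 then {{}} else {})"
    by (auto simp: ideals_empty)
  then show ?thesis by (simp add: pattern_count_def)
qed

text \<open>\<open>{}\<close> and \<open>S\<close> are two distinct ideals; geometrically, constant
  vectors lie in every recession cone.\<close>

lemma pattern_count_0:
  assumes "finite S" "S \<noteq> {}" shows "pattern_count D S 0 = 0"
proof -
  have "card (ideals S P) \<noteq> Suc 0" for P
    using empty_ideal[of S P] full_ideal[of S P] assms(2) by (auto simp: card_1_singleton_iff)
  then show ?thesis by (simp add: pattern_count_def)
qed

text \<open>The count of level \<open>l \<ge> 2\<close> is a convolution over proper nonempty subsets, so the total numbers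
  of patterns determine the counts of every level, that of level \<open>1\<close> being what is left.\<close>

theorem pattern_count_determined:
  assumes "differences S0 D" "differences S0' D'"
    and total: "\<And>S. S \<subseteq> S0 \<Longrightarrow> card (patterns D S) = t (card S)"
    and total': "\<And>S. S \<subseteq> S0' \<Longrightarrow> card (patterns D' S) = t (card S)"
    and "S \<subseteq> S0" "S' \<subseteq> S0'" "card S = card S'"
  shows "pattern_count D S l = pattern_count D' S' l"
  using assms(5-)
proof (induction "card S" arbitrary: S S' l rule: less_induct)
  case less
  interpret d: differences S0 D by fact
  interpret d': differences S0' D' by fact
  have fin: "finite S" "finite S'" using less.prems d.finite_sub d'.finite_sub by auto
  show ?case
  proof (cases "S = {}")
    case True
    then have "S' = {}" using less.prems fin by simp
    then show ?thesis using True by (simp add: pattern_count_empty)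
  next
    case False
    then have ne: "S' \<noteq> {}" using less.prems fin by auto
    obtain b where b: "bij_betw b S S'" using finite_same_card_bij[OF fin] less.prems by auto
    have ge2: "pattern_count D S (Suc (Suc m)) = pattern_count D' S' (Suc (Suc m))" for m
    proof -
      have "pattern_count D T 1 * pattern_count D (S - T) (Suc m) =
          pattern_count D' (b ` T) 1 * pattern_count D' (S' - b ` T) (Suc m)" if "T \<in> Pow S" for T
      proof -
        have TS: "T \<subseteq> S" using that by simp
        have inj: "inj_on b S" "b ` S = S'" using b by (auto simp: bij_betw_def)
        have diff: "S' - b ` T = b ` (S - T)" using inj TS by (simp add: inj_on_image_set_diff)
        have sub: "b ` T \<subseteq> S0'" "b ` (S - T) \<subseteq> S0'" "T \<subseteq> S0" "S - T \<subseteq> S0"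
          using inj TS less.prems by auto
        have c: "card T = card (b ` T)" "card (S - T) = card (b ` (S - T))"
          using inj(1) TS by (metis card_image inj_on_subset, metis card_image inj_on_subset Diff_subset)
        \<comment> \<open>For \<open>T = {}\<close> or \<open>T = S\<close> one factor on each side
          is a count of positive level on the empty set, which is \<open>0\<close>; otherwise both
          parts are smaller than \<open>S\<close> and the induction hypothesis applies.\<close>
        consider "T = {}" | "T = S" | "T \<noteq> {}" "T \<noteq> S" by blast
        then show ?thesis
        proof cases
          case 3
          have "card T < card S" "card (S - T) < card S"
            using 3 TS fin by (auto intro!: psubset_card_mono)
          then show ?thesis
            unfolding diff using less.hyps[OF _ sub(3,1) c(1)] less.hyps[OF _ sub(4,2) c(2)] by simp
        qed (use inj in \<open>simp_all add: pattern_count_empty\<close>)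
      qed
      then have "(\<Sum>T\<in>Pow S. pattern_count D T 1 * pattern_count D (S - T) (Suc m)) =
          (\<Sum>T\<in>Pow S. pattern_count D' (b ` T) 1 * pattern_count D' (S' - b ` T) (Suc m))"
        by (rule sum.cong[OF refl])
      also have "\<dots> = (\<Sum>T\<in>Pow S'. pattern_count D' T 1 * pattern_count D' (S' - T) (Suc m))"
        using b by (intro sum.reindex_bij_betw bij_betw_Pow)
      finally show ?thesis
        using d.pattern_count_add[OF less.prems(1), of 1 "Suc m"]
          d'.pattern_count_add[OF less.prems(2), of 1 "Suc m"] by simp
    qed
    have z: "pattern_count D S 0 = pattern_count D' S' 0"
      using pattern_count_0[OF fin(1) False] pattern_count_0[OF fin(2) ne] by simp
    have not1: "pattern_count D S m = pattern_count D' S' m" if "m \<noteq> 1" for m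
      using that z ge2[of "m - 2"] by (cases m; cases "m - 1") auto
    \<comment> \<open>Level \<open>1\<close> occurs among the summands since \<open>S\<close> is
      nonempty; subtracting the levels already matched from the equal totals leaves it.\<close>
    have "1 \<in> {..card S}" using False fin by (simp add: Suc_le_eq card_gt_0_iff)
    then have "pattern_count D S 1 + (\<Sum>m\<in>{..card S} - {1}. pattern_count D S m) =
        pattern_count D' S' 1 + (\<Sum>m\<in>{..card S} - {1}. pattern_count D' S' m)"
      using d.card_patterns_eq_sum[OF less.prems(1)] d'.card_patterns_eq_sum[OF less.prems(2)]
        total[OF less.prems(1)] total'[OF less.prems(2)] less.prems(3)
      by (simp flip: sum.remove)
    moreover have "(\<Sum>m\<in>{..card S} - {1}. pattern_count D S m) =
        (\<Sum>m\<in>{..card S} - {1}. pattern_count D' S' m)"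
      using not1 by (intro sum.cong) auto
    ultimately show ?thesis using not1[of l] by (cases "l = 1") auto
  qed
qed

section \<open>Regions of deformations of the braid arrangement\<close>

lemma Rn_iff: "x \<in> Rn n \<longleftrightarrow> (\<forall>i\<ge>n. x i = 0)"
  by (simp add: topspace_Euclidean_space)

abbreviation unit_vector :: "nat \<Rightarrow> nat \<Rightarrow> real"
  where "unit_vector k \<equiv> indicator {k}"

definition diff_hyperplane :: "nat \<Rightarrow> nat \<Rightarrow> nat \<Rightarrow> real \<Rightarrow> (nat \<Rightarrow> real) set"
  where "diff_hyperplane n i j a = {x \<in> Rn n. x i - x j = a}"

definition offsets :: "nat \<Rightarrow> (nat \<Rightarrow> real) set set \<Rightarrow> nat \<Rightarrow> nat \<Rightarrow> real set"
  where "offsets n \<B> i j = {a. diff_hyperplane n i j a \<in> \<B>}"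

lemma diff_hyperplane_swap: "diff_hyperplane n j i (- a) = diff_hyperplane n i j a"
  by (auto simp: diff_hyperplane_def)

lemma unit_vector_Rn: "k < n \<Longrightarrow> c *\<^sub>R unit_vector k \<in> Rn n"
  by (auto simp: Rn_iff scaleR_fun_def indicator_def)

text \<open>Testing the two linear equations on \<open>unit_vector k\<close> and on
  \<open>unit_vector i + unit_vector j\<close> shows that \<open>w\<close> is a nonzero multiple of
  \<open>unit_vector i - unit_vector j\<close>.\<close>

lemma hyperplane_parallel_braid:
  assumes w: "w \<in> Rn n" "w \<noteq> 0" and ij: "i \<noteq> j" "i < n" "j < n"
    and eq: "hyperplane n w 0 = {x \<in> Rn n. x i - x j = 0}"
  shows "hyperplane n w a = diff_hyperplane n i j (a / w i)"
proof -
  have in_eq: "(\<Sum>k<n. w k * x k) = 0 \<longleftrightarrow> x i - x j = 0" if "x \<in> Rn n" for x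
    using eq that by (auto simp: hyperplane_def)
  have other: "w k = 0" if "k \<noteq> i" "k \<noteq> j" for k
  proof (cases "k < n")
    case True
    have "(\<Sum>l<n. w l * unit_vector k l) = 0"
      using in_eq[of "unit_vector k"] unit_vector_Rn[OF True, of 1] that by simp
    moreover have "(\<Sum>l<n. w l * unit_vector k l) = (\<Sum>l\<in>{k}. w l * unit_vector k l)"
      using True by (intro sum.mono_neutral_right) auto
    ultimately show ?thesis by simp
  qed (use w in \<open>auto simp: Rn_iff\<close>)
  have val: "(\<Sum>k<n. w k * x k) = w i * x i + w j * x j" for x :: "nat \<Rightarrow> real"
  proof -
    have "(\<Sum>k<n. w k * x k) = (\<Sum>k\<in>{i, j}. w k * x k)"
      using ij other by (intro sum.mono_neutral_right) auto
    then show ?thesis using ij by simp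
  qed
  have "unit_vector i + unit_vector j \<in> Rn n"
    using ij by (auto simp: Rn_iff indicator_def)
  from in_eq[OF this] have wj: "w j = - w i" using ij by (simp add: val)
  have "w i \<noteq> 0"
  proof
    assume "w i = 0"
    then have "w k = 0" for k using other wj by (cases "k = i"; cases "k = j") auto
    then show False using w by auto
  qed
  moreover have "w i * x i + w j * x j = w i * (x i - x j)" for x :: "nat \<Rightarrow> real"
    by (simp add: wj algebra_simps)
  ultimately show ?thesis
    unfolding hyperplane_def diff_hyperplane_def val by (auto simp: field_simps)
qed

lemma diff_hyperplane_inj:
  assumes "i \<noteq> j" "i < n" "diff_hyperplane n i j a = diff_hyperplane n i j b"
  shows "a = b"
proof -
  have "a *\<^sub>R unit_vector i \<in> diff_hyperplane n i j a"
    using assms(1) unit_vector_Rn[OF assms(2)] by (simp add: diff_hyperplane_def scaleR_fun_def)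
  then show ?thesis using assms(1) unfolding assms(3) by (simp add: diff_hyperplane_def scaleR_fun_def)
qed

lemma patterns_Rn:
  assumes "S \<subseteq> {..<n}"
  shows "patterns D S = pattern D S ` {x \<in> Rn n. generic D S x}"
proof
  show "patterns D S \<subseteq> pattern D S ` {x \<in> Rn n. generic D S x}"
  proof
    fix P assume "P \<in> patterns D S"
    then obtain x where x: "generic D S x" "P = pattern D S x" by (auto simp: patterns_def)
    define y where "y i = (if i < n then x i else 0)" for i
    have y: "y i = x i" if "i \<in> S" for i using that assms by (auto simp: y_def)
    have "y \<in> Rn n" by (simp add: y_def Rn_iff)
    moreover have "generic D S y" "P = pattern D S y"
      using x y by (auto simp: generic_def pattern_def)
    ultimately show "P \<in> pattern D S ` {x \<in> Rn n. generic D S x}" by blast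
  qed
qed (auto simp: patterns_def)

locale braid_deformation =
  fixes n :: nat and \<B> :: "(nat \<Rightarrow> real) set set"
  assumes arr: "arrangement n \<B>" and under: "underline_arr n \<B> = Braid n"
begin

abbreviation "D \<equiv> offsets n \<B>"

lemma finite_B: "finite \<B>"
  using arr by (simp add: arrangement_def)

lemma hyperplane_cases:
  assumes "H \<in> \<B>"
  obtains i j a where "i \<noteq> j" "i < n" "j < n" "H = diff_hyperplane n i j a" "a \<in> D i j"
proof -
  obtain w a where w: "w \<in> Rn n" "w \<noteq> 0" "H = hyperplane n w a"
    using arr assms unfolding arrangement_def by blast
  then have "hyperplane n w 0 \<in> Braid n"
    using assms under[symmetric] by (auto simp: underline_arr_def)
  then obtain i j where ij: "i < j" "j < n" "hyperplane n w 0 = {x \<in> Rn n. x i - x j = 0}"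
    by (auto simp: Braid_def)
  then have "H = diff_hyperplane n i j (a / w i)"
    unfolding w(3) by (intro hyperplane_parallel_braid w) auto
  then show thesis using that[of i j "a / w i"] ij assms by (auto simp: offsets_def)
qed

lemma offset_exists:
  assumes "i < j" "j < n"
  shows "\<exists>a. diff_hyperplane n i j a \<in> \<B>"
proof -
  have "{x \<in> Rn n. x i - x j = 0} \<in> underline_arr n \<B>"
    using assms under by (auto simp: Braid_def)
  then obtain w a where w: "w \<in> Rn n" "w \<noteq> 0" "hyperplane n w a \<in> \<B>"
    "hyperplane n w 0 = {x \<in> Rn n. x i - x j = 0}"
    unfolding underline_arr_def by auto
  then have "hyperplane n w a = diff_hyperplane n i j (a / w i)"
    using assms by (intro hyperplane_parallel_braid) auto
  then show ?thesis using w by metis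
qed

sublocale differences "{..<n}" D
proof
  fix i j assume ij: "i \<in> {..<n}" "j \<in> {..<n}" "i \<noteq> j"
  have "inj_on (diff_hyperplane n i j) UNIV"
    using ij diff_hyperplane_inj by (auto intro!: inj_onI)
  then have "finite (diff_hyperplane n i j -` \<B>)" using finite_B by (intro finite_vimageI) auto
  then show "finite (D i j)" by (simp add: offsets_def vimage_def)
  show "D i j \<noteq> {}"
  proof (cases "i < j")
    case True
    then show ?thesis using offset_exists[of i j] ij by (auto simp: offsets_def)
  next
    case False
    then obtain a where "diff_hyperplane n j i a \<in> \<B>" using offset_exists[of j i] ij by auto
    then have "- a \<in> D i j" by (simp add: offsets_def diff_hyperplane_swap)
    then show ?thesis by blast
  qed
next
  fix i j a assume "a \<in> D i j"
  then show "- a \<in> D j i" by (simp add: offsets_def diff_hyperplane_swap)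
qed simp

lemma complement_eq: "Rn n - \<Union>\<B> = {x \<in> Rn n. generic D {..<n} x}"
proof
  show "Rn n - \<Union>\<B> \<subseteq> {x \<in> Rn n. generic D {..<n} x}"
    by (auto simp: generic_def offsets_def diff_hyperplane_def)
  show "{x \<in> Rn n. generic D {..<n} x} \<subseteq> Rn n - \<Union>\<B>"
  proof clarify
    fix x H assume "generic D {..<n} x" "H \<in> \<B>" "x \<in> H"
    then show False
      by (elim hyperplane_cases) (auto simp: generic_def diff_hyperplane_def)
  qed
qed

section \<open>Regions as cells of patterns\<close>

definition cell :: "(nat \<times> nat \<times> real) set \<Rightarrow> (nat \<Rightarrow> real) set"
  where "cell P = {x \<in> Rn n. generic D {..<n} x \<and> pattern D {..<n} x = P}"

text \<open>A cell is cut out of \<open>Rn n\<close> by strict linear inequalities, so the straight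
  path \<open>\<gamma>\<close> stays inside; its continuity is checked coordinatewise.\<close>

lemma connected_cell: "connected (cell P)"
  unfolding connected_iff_connected_component
proof (intro ballI)
  fix x y assume x: "x \<in> cell P" and y: "y \<in> cell P"
  define \<gamma> where "\<gamma> = (\<lambda>(t::real) i. (1 - t) * x i + t * y i)"
  have "continuous_on {0..1} \<gamma>"
    unfolding \<gamma>_def
    by (rule continuous_on_coordinatewise_then_product)
      (intro continuous_on_add continuous_on_mult continuous_on_diff continuous_on_id continuous_on_const)
  then have "connected (\<gamma> ` {0..1})" by (intro connected_continuous_image) auto
  moreover have "x = \<gamma> 0" "y = \<gamma> 1" by (simp_all add: \<gamma>_def)
  then have "x \<in> \<gamma> ` {0..1}" "y \<in> \<gamma> ` {0..1}" by auto
  moreover have "\<gamma> t \<in> cell P" if t: "t \<in> {0..1}" for t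
  proof -
    have side: "\<gamma> t i - \<gamma> t j \<noteq> a \<and> (\<gamma> t i - \<gamma> t j < a \<longleftrightarrow> x i - x j < a)"
      if ij: "i < n" "j < n" "i \<noteq> j" "a \<in> D i j" for i j a
    proof -
      have g: "x i - x j \<noteq> a" "y i - y j \<noteq> a"
        using x y ij by (auto simp: cell_def generic_def)
      have "(i, j, a) \<in> pattern D {..<n} x \<longleftrightarrow> (i, j, a) \<in> pattern D {..<n} y"
        using x y by (simp add: cell_def)
      then have s: "x i - x j < a \<longleftrightarrow> y i - y j < a" using ij by (simp add: pattern_def)
      have eq: "\<gamma> t i - \<gamma> t j - a = (1 - t) * (x i - x j - a) + t * (y i - y j - a)"
        by (simp add: \<gamma>_def algebra_simps)
      show ?thesis
      proof (cases "x i - x j < a")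
        case True
        then have "(1 - t) * (x i - x j - a) + t * (y i - y j - a) < 0"
          using s t by (intro convex_bound_lt) auto
        then show ?thesis using True eq by linarith
      next
        case False
        then have "(1 - t) * - (x i - x j - a) + t * - (y i - y j - a) < 0"
          using s g t by (intro convex_bound_lt) auto
        then have "\<gamma> t i - \<gamma> t j > a" using eq by (simp only: mult_minus_right)
        then show ?thesis using False by simp
      qed
    qed
    have "\<gamma> t \<in> Rn n" using x y by (auto simp: cell_def Rn_iff \<gamma>_def)
    moreover have "generic D {..<n} (\<gamma> t)" using side by (auto simp: generic_def)
    moreover have "pattern D {..<n} (\<gamma> t) = pattern D {..<n} x"
      using side by (auto simp: pattern_def)
    ultimately show ?thesis using x by (simp add: cell_def)
  qed
  ultimately show "connected_component (cell P) x y"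
    unfolding connected_component_def by (intro exI[of _ "\<gamma> ` {0..1}"]) auto
qed

text \<open>A coordinate difference maps the connected set to an interval that misses its offsets.
  One inclusion suffices, as \<open>x\<close> and \<open>y\<close> may be exchanged.\<close>

lemma pattern_constant_on_connected:
  assumes T: "connected T" "T \<subseteq> {x \<in> Rn n. generic D {..<n} x}" "x \<in> T" "y \<in> T"
  shows "pattern D {..<n} x \<subseteq> pattern D {..<n} y"
proof clarify
  fix i j a assume P: "(i, j, a) \<in> pattern D {..<n} x"
  then have ij: "i < n" "j < n" "i \<noteq> j" "a \<in> D i j" "x i - x j < a" by (auto simp: pattern_def)
  have "continuous_on T (\<lambda>z. z i - z j)"
    by (intro continuous_on_diff continuous_on_subset[OF continuous_on_product_coordinates]) auto
  then have "connected ((\<lambda>z. z i - z j) ` T)" using T(1) by (rule connected_continuous_image)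
  moreover have "x i - x j \<in> (\<lambda>z. z i - z j) ` T" "y i - y j \<in> (\<lambda>z. z i - z j) ` T"
    using T(3,4) by auto
  moreover have "a \<notin> (\<lambda>z. z i - z j) ` T" using T(2) ij by (auto simp: generic_def)
  ultimately have "\<not> a \<le> y i - y j"
    using connectedD_interval[of "(\<lambda>z. z i - z j) ` T" "x i - x j" "y i - y j" a] ij(5) by auto
  then show "(i, j, a) \<in> pattern D {..<n} y" using ij by (auto simp: pattern_def)
qed

lemma regions_eq: "regions n \<B> = cell ` patterns D {..<n}"
proof -
  let ?U = "{x \<in> Rn n. generic D {..<n} x}"
  \<comment> \<open>\<open>Euclidean_space n\<close> is a subspace of the product topology, so
    components can be computed in the type class topology on functions, to which
    \<open>connected\<close> refers.\<close>
  have top: "subtopology (Euclidean_space n) (Rn n - \<Union>\<B>) = top_of_set ?U"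
  proof -
    have "{x. \<forall>i\<ge>n. x i = 0} \<inter> ?U = ?U" by (auto simp: Rn_iff)
    then show ?thesis
      unfolding complement_eq unfolding Euclidean_space_def[of n]
      by (simp add: subtopology_subtopology euclidean_product_topology)
  qed
  have comp: "connected_component_of_set (top_of_set ?U) x = cell (pattern D {..<n} x)"
    if x: "x \<in> ?U" for x
  proof
    show "connected_component_of_set (top_of_set ?U) x \<subseteq> cell (pattern D {..<n} x)"
    proof
      fix y assume "y \<in> connected_component_of_set (top_of_set ?U) x"
      then obtain T where T: "connected T" "T \<subseteq> ?U" "x \<in> T" "y \<in> T"
        by (auto simp: connected_component_of_def connectedin_subtopology)
      then show "y \<in> cell (pattern D {..<n} x)"
        using pattern_constant_on_connected[OF T] pattern_constant_on_connected[OF T(1,2,4,3)]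
        by (auto simp: cell_def)
    qed
    have "cell (pattern D {..<n} x) \<subseteq> ?U" by (auto simp: cell_def)
    moreover have "x \<in> cell (pattern D {..<n} x)" using x by (auto simp: cell_def)
    ultimately show "cell (pattern D {..<n} x) \<subseteq> connected_component_of_set (top_of_set ?U) x"
      using connected_cell by (force simp: connected_component_of_def connectedin_subtopology)
  qed
  have "regions n \<B> = (\<lambda>x. cell (pattern D {..<n} x)) ` ?U"
    unfolding regions_def top connected_components_of_def
    by (rule image_cong) (use comp in auto)
  also have "\<dots> = cell ` pattern D {..<n} ` ?U" by (simp add: image_image)
  also have "pattern D {..<n} ` ?U = patterns D {..<n}"
    by (rule patterns_Rn[symmetric]) simp
  finally show ?thesis .
qed

end

section \<open>Recession cones and levels\<close>

text \<open>The largest set \<open>W\<close> has a point \<open>w\<close> outside all the others,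
  and everything in the span of their indicators vanishes at \<open>w\<close>.\<close>

lemma independent_indicators:
  fixes C :: "'a set set"
  assumes "finite C" "{} \<notin> C" "\<And>X Y. X \<in> C \<Longrightarrow> Y \<in> C \<Longrightarrow> X \<subseteq> Y \<or> Y \<subseteq> X"
  shows "independent ((indicator :: 'a set \<Rightarrow> 'a \<Rightarrow> real) ` C)"
  using assms
proof (induction "card C" arbitrary: C)
  case 0
  then show ?case by (simp add: independent_empty)
next
  case (Suc m)
  let ?ind = "indicator :: 'a set \<Rightarrow> 'a \<Rightarrow> real"
  have "C \<noteq> {}" using Suc.hyps(2) by auto
  then obtain W where W: "W \<in> C" "\<And>X. X \<in> C \<Longrightarrow> W \<subseteq> X \<Longrightarrow> X = W"
    using finite_has_maximal[OF \<open>finite C\<close>] by blast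
  define C' where "C' = C - {W}"
  have C': "X \<subset> W" if "X \<in> C'" for X
    using W Suc.prems(3)[of X W] that by (auto simp: C'_def)
  have IH: "independent (?ind ` C')"
    using Suc.hyps(2) Suc.prems W by (intro Suc.hyps(1)) (auto simp: C'_def)
  have "\<exists>w\<in>W. \<forall>X\<in>C'. w \<notin> X"
  proof (cases "C' = {}")
    case True
    then show ?thesis using W(1) Suc.prems(2) by (metis all_not_in_conv)
  next
    case False
    have "finite C'" using Suc.prems by (simp add: C'_def)
    then obtain V where V: "V \<in> C'" "\<And>X. X \<in> C' \<Longrightarrow> V \<subseteq> X \<Longrightarrow> X = V"
      using finite_has_maximal[OF _ False] by blast
    then obtain w where "w \<in> W" "w \<notin> V" using C' by blast
    moreover have "X \<subseteq> V" if "X \<in> C'" for X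
      using V(1) V(2)[OF that] Suc.prems(3)[of X V] that by (auto simp: C'_def)
    ultimately show ?thesis by blast
  qed
  then obtain w where w: "w \<in> W" "\<And>X. X \<in> C' \<Longrightarrow> w \<notin> X" by blast
  have "subspace {v :: 'a \<Rightarrow> real. v w = 0}"
    by (auto simp: subspace_def scaleR_fun_def)
  moreover have "?ind ` C' \<subseteq> {v. v w = 0}" using w(2) by auto
  ultimately have "span (?ind ` C') \<subseteq> {v. v w = 0}" by (intro span_minimal)
  then have "?ind W \<notin> span (?ind ` C')" using w(1) by auto
  then have "independent (insert (?ind W) (?ind ` C'))" using IH by (rule independent_insertI)
  moreover have "insert (?ind W) (?ind ` C') = ?ind ` C" using W(1) by (auto simp: C'_def)
  ultimately show ?case by simp
qed

lemma indicator_inj: "inj (indicator :: 'a set \<Rightarrow> 'a \<Rightarrow> real)"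
  by (rule injI) (metis indicator_eq_1_iff subsetI subset_antisym)

text \<open>Induction on the number of values of \<open>v\<close> on \<open>S\<close>. Lowering the
  top value \<open>M\<close> to the next value \<open>N\<close> subtracts a multiple of the
  indicator of the set where \<open>v\<close> equals \<open>M\<close>. The rest \<open>T\<close> of
  \<open>S\<close> is an ideal since \<open>v\<close> does not decrease along arcs, and
  \<open>T \<noteq> S\<close> since the maximum is attained.\<close>

lemma monotone_in_span_ideals:
  fixes v :: "'v \<Rightarrow> real"
  assumes "finite S" "\<And>i. i \<notin> S \<Longrightarrow> v i = 0" "\<And>i j a. (i, j, a) \<in> P \<Longrightarrow> v i \<le> v j"
    and "\<And>i j a. (i, j, a) \<in> P \<Longrightarrow> i \<in> S \<and> j \<in> S"
  shows "v \<in> span ((\<lambda>T. indicator (S - T)) ` (ideals S P - {S}))"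
  using assms(2,3)
proof (induction "card (v ` S)" arbitrary: v rule: less_induct)
  case less
  let ?B = "(\<lambda>T. indicator (S - T) :: 'v \<Rightarrow> real) ` (ideals S P - {S})"
  show ?case
  proof (cases "S = {}")
    case True
    then have "v = 0" using less.prems by (auto simp: fun_eq_iff)
    then show ?thesis by (simp only: span_zero)
  next
    case False
    define M where "M = Max (v ` S)"
    have M: "v i \<le> M" if "i \<in> S" for i using that \<open>finite S\<close> by (simp add: M_def)
    have "M \<in> v ` S" using False \<open>finite S\<close> by (simp add: M_def)
    then obtain m where m: "m \<in> S" "v m = M" by auto
    define T where "T = {i \<in> S. v i < M}"
    have "T \<in> ideals S P"
      using less.prems(2) by (fastforce simp: ideals_def T_def)
    moreover have "T \<noteq> S" using m by (auto simp: T_def)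
    ultimately have T: "indicator (S - T) \<in> ?B" by blast
    show ?thesis
    proof (cases "T = {}")
      case True
      \<comment> \<open>No smaller value is left: \<open>v\<close> is constant on \<open>S\<close>,
        a multiple of the indicator belonging to the ideal \<open>{}\<close>.\<close>
      have "v = M *\<^sub>R indicator (S - T)"
      proof
        fix i show "v i = (M *\<^sub>R indicator (S - T)) i"
          using True M[of i] less.prems(1)[of i]
          by (cases "i \<in> S") (auto simp: scaleR_fun_def T_def)
      qed
      then show ?thesis using T by (metis span_base span_scale)
    next
      case nonempty: False
      have finT: "finite T" using \<open>finite S\<close> by (simp add: T_def)
      define N where "N = Max (v ` T)"
      have "N \<in> v ` T" using nonempty finT by (simp add: N_def)
      then have "N < M" by (auto simp: T_def)
      have N: "v i \<le> N" if "i \<in> S" "v i < M" for i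
        unfolding N_def using that finT by (intro Max_ge) (auto simp: T_def)
      define u where "u i = (if i \<in> S then min (v i) N else 0)" for i
      have "u ` S \<subseteq> v ` S" using \<open>N \<in> v ` T\<close> by (auto simp: u_def T_def min_def)
      moreover have "M \<notin> u ` S" using \<open>N < M\<close> by (auto simp: u_def)
      ultimately have "card (u ` S) < card (v ` S)"
        using \<open>M \<in> v ` S\<close> \<open>finite S\<close> by (intro psubset_card_mono) auto
      moreover have "u i \<le> u j" if "(i, j, a) \<in> P" for i j a
        using less.prems(2)[OF that] assms(4)[OF that] by (auto simp: u_def)
      ultimately have "u \<in> span ?B" by (intro less.hyps) (auto simp: u_def)
      moreover have "v = u + (M - N) *\<^sub>R indicator (S - T)"
      proof
        fix i show "v i = (u + (M - N) *\<^sub>R indicator (S - T)) i"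
          using M[of i] N[of i] less.prems(1)[of i] \<open>N < M\<close>
          by (cases "i \<in> S"; cases "v i < M") (auto simp: scaleR_fun_def T_def u_def)
      qed
      ultimately show ?thesis using T by (metis span_add span_base span_scale)
    qed
  qed
qed

text \<open>This serves to compare two encodings of the same regions, by sign vectors and by
  patterns.\<close>

lemma card_image_cong_kernel:
  assumes "\<And>x y. x \<in> X \<Longrightarrow> y \<in> X \<Longrightarrow> p x = p y \<longleftrightarrow> q x = q y"
  shows "card (p ` X) = card (q ` X)"
proof -
  have inv: "inv_into X p (p x) \<in> X" "p (inv_into X p (p x)) = p x" if "x \<in> X" for x
    using that by (auto intro: inv_into_into f_inv_into_f)
  then have q: "q (inv_into X p (p x)) = q x" if "x \<in> X" for x
    using assms that by blast
  have "bij_betw (\<lambda>c. q (inv_into X p c)) (p ` X) (q ` X)"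
    unfolding bij_betw_def
  proof
    show "inj_on (\<lambda>c. q (inv_into X p c)) (p ` X)"
      using assms q by (auto intro!: inj_onI)
    show "(\<lambda>c. q (inv_into X p c)) ` p ` X = q ` X"
      using q by (auto simp: image_image)
  qed
  then show ?thesis by (rule bij_betw_same_card)
qed

context braid_deformation
begin

text \<open>Adding \<open>v\<close> with \<open>v i \<le> v j\<close> along arcs preserves each arc,
  and each absent arc because its reverse is present. Conversely, \<open>x\<close> plus any natural
  multiple of a recession vector stays in the cell, whereas a linearly growing coordinate difference
  would eventually pass its offset.\<close>

lemma Rec_cell:
  assumes x: "x \<in> Rn n" "generic D {..<n} x"
  shows "Rec n (cell (pattern D {..<n} x)) =
    {v \<in> Rn n. \<forall>(i, j, a)\<in>pattern D {..<n} x. v i \<le> v j}" (is "Rec n ?R = ?V")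
proof
  show "?V \<subseteq> Rec n ?R"
  proof
    fix v assume v: "v \<in> ?V"
    have "y + v \<in> ?R" if y: "y \<in> ?R" for y
    proof -
      have P: "pattern D {..<n} y = pattern D {..<n} x" "generic D {..<n} y"
        using y by (auto simp: cell_def)
      have side: "(y + v) i - (y + v) j \<noteq> a \<and> ((y + v) i - (y + v) j < a \<longleftrightarrow> y i - y j < a)"
        if ij: "i < n" "j < n" "i \<noteq> j" "a \<in> D i j" for i j a
      proof (cases "y i - y j < a")
        case True
        then have "(i, j, a) \<in> pattern D {..<n} y" using ij by (simp add: pattern_def)
        then have "v i \<le> v j" using v unfolding P by auto
        then show ?thesis using True by auto
      next
        case False
        then have "(i, j, a) \<notin> pattern D {..<n} y" by (simp add: pattern_def)
        then have "(j, i, - a) \<in> pattern D {..<n} y"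
          using arc_or_reverse[of "{..<n}" y i j a] P(2) ij by auto
        then have "v j \<le> v i" using v unfolding P by auto
        moreover have "y i - y j \<noteq> a" using P(2) ij by (auto simp: generic_def)
        ultimately show ?thesis using False by auto
      qed
      have "generic D {..<n} (y + v)" using side by (auto simp: generic_def)
      moreover have "pattern D {..<n} (y + v) = pattern D {..<n} y"
        using side by (auto simp: pattern_def)
      moreover have "y + v \<in> Rn n" using y v by (auto simp: cell_def Rn_iff)
      ultimately show ?thesis using P by (simp add: cell_def)
    qed
    then show "v \<in> Rec n ?R" using v by (auto simp: Rec_def)
  qed
  show "Rec n ?R \<subseteq> ?V"
  proof
    fix v assume v: "v \<in> Rec n ?R"
    have step: "y + v \<in> ?R" if "y \<in> ?R" for y using v that by (auto simp: Rec_def)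
    have iter: "x + real k *\<^sub>R v \<in> ?R" for k
    proof (induction k)
      case 0
      then show ?case using x by (simp add: cell_def)
    next
      case (Suc k)
      have "x + real (Suc k) *\<^sub>R v = (x + real k *\<^sub>R v) + v" by (simp add: algebra_simps)
      then show ?case using step[OF Suc] by (simp only:)
    qed
    have "v i \<le> v j" if P: "(i, j, a) \<in> pattern D {..<n} x" for i j a
    proof (rule ccontr)
      assume "\<not> v i \<le> v j"
      then obtain k where k: "a - (x i - x j) < real k * (v i - v j)"
        using reals_Archimedean3[of "v i - v j"] by auto
      have "pattern D {..<n} (x + real k *\<^sub>R v) = pattern D {..<n} x"
        using iter[of k] by (simp add: cell_def)
      then have "(i, j, a) \<in> pattern D {..<n} (x + real k *\<^sub>R v)" using P by simp
      then have "(x i + real k * v i) - (x j + real k * v j) < a"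
        by (simp add: pattern_def scaleR_fun_def)
      then show False using k by (simp add: algebra_simps)
    qed
    then show "v \<in> ?V" using v by (auto simp: Rec_def)
  qed
qed

text \<open>The indicators of complements of ideals lie in the recession cone, span it, and are
  independent because the complements form a chain of nonempty sets. The ideal \<open>{..<n}\<close>
  is left out as its complement is empty, which accounts for the \<open>Suc\<close>.\<close>

lemma level_cell:
  assumes P: "P \<in> patterns D {..<n}"
  shows "Suc (level n (cell P)) = card (ideals {..<n} P)"
proof -
  let ?S = "{..<n}"
  let ?u = "\<lambda>T. indicator (?S - T) :: nat \<Rightarrow> real"
  let ?I = "ideals ?S P - {?S}"
  obtain x where x: "x \<in> Rn n" "generic D ?S x" "P = pattern D ?S x"
    using P patterns_Rn[of ?S n D] by auto
  define V where "V = {v \<in> Rn n. \<forall>(i, j, a)\<in>P. v i \<le> v j}"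
  have Rec: "Rec n (cell P) = V" unfolding V_def x(3) by (rule Rec_cell[OF x(1,2)])
  have inS: "i \<in> ?S \<and> j \<in> ?S" if "(i, j, a) \<in> P" for i j a using that x(3) by (auto simp: pattern_def)
  have ind: "independent (?u ` ?I)"
  proof -
    define C where "C = (\<lambda>T. ?S - T) ` ?I"
    have "finite C" by (simp add: C_def finite_ideals)
    moreover have "{} \<notin> C" by (auto simp: C_def ideals_def)
    moreover have "X \<subseteq> Y \<or> Y \<subseteq> X" if XY: "X \<in> C" "Y \<in> C" for X Y
    proof -
      obtain T U where "T \<in> ideals ?S P" "U \<in> ideals ?S P" "X = ?S - T" "Y = ?S - U"
        using XY by (auto simp: C_def)
      then show ?thesis using ideals_chain[OF order_refl P, of T U] by blast
    qed
    ultimately have "independent ((indicator :: nat set \<Rightarrow> nat \<Rightarrow> real) ` C)"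
      by (rule independent_indicators)
    then show ?thesis by (simp add: C_def image_image)
  qed
  have inj: "inj_on ?u ?I"
  proof (rule inj_onI)
    fix T U assume TU: "T \<in> ?I" "U \<in> ?I" "?u T = ?u U"
    then have "?S - T = ?S - U" using indicator_inj by (meson injD)
    moreover have "T \<subseteq> ?S" "U \<subseteq> ?S" using TU by (auto simp: ideals_def)
    ultimately show "T = U" by blast
  qed
  have "V \<subseteq> span (?u ` ?I)"
  proof
    fix v assume "v \<in> V"
    then show "v \<in> span (?u ` ?I)"
      using inS by (intro monotone_in_span_ideals) (auto simp: V_def Rn_iff)
  qed
  moreover have "?u ` ?I \<subseteq> V"
  proof (rule image_subsetI)
    fix T assume T: "T \<in> ?I"
    have "?u T i \<le> ?u T j" if "(i, j, a) \<in> P" for i j a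
      using T that inS[OF that] by (auto simp: ideals_def indicator_def)
    then show "?u T \<in> V" by (auto simp: V_def Rn_iff)
  qed
  ultimately have "dim V = card (?u ` ?I)" using ind by (intro dim_unique[of "?u ` ?I"]) auto
  then have "level n (cell P) = card ?I"
    using inj by (simp add: level_def Rec card_image)
  moreover have "card (ideals ?S P) = Suc (card ?I)"
    using card_Suc_Diff1[OF finite_ideals full_ideal[of ?S P]] by simp
  ultimately show ?thesis by simp
qed

theorem num_regions_of_level_eq: "num_regions_of_level l n \<B> = pattern_count D {..<n} l"
proof -
  have "{R \<in> regions n \<B>. level n R = l} =
      cell ` {P \<in> patterns D {..<n}. card (ideals {..<n} P) = Suc l}"
    unfolding regions_eq using level_cell by (auto simp: image_iff) (metis Suc_inject)+
  moreover have "inj_on cell (patterns D {..<n})"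
  proof (rule inj_onI)
    fix P Q assume P: "P \<in> patterns D {..<n}" and eq: "cell P = cell Q"
    obtain x where "x \<in> Rn n" "generic D {..<n} x" "P = pattern D {..<n} x"
      using P patterns_Rn[of "{..<n}" n D] by auto
    then have "x \<in> cell P" by (simp add: cell_def)
    then have "x \<in> cell P" "x \<in> cell Q" using eq by auto
    then show "P = Q" by (simp add: cell_def)
  qed
  then have "inj_on cell {P \<in> patterns D {..<n}. card (ideals {..<n} P) = Suc l}"
    by (rule inj_on_subset) auto
  ultimately show ?thesis
    by (simp add: num_regions_of_level_def pattern_count_def card_image)
qed

end

section \<open>Exponential sequences\<close>

lemma affine_fun_diff: "affine_fun (\<lambda>x :: nat \<Rightarrow> real. x i - x j - a)"
  by (simp add: affine_fun_def scaleR_fun_def algebra_simps)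

lemma affine_Rn: "affine (Rn n)"
  by (simp add: affine_def Rn_iff scaleR_fun_def)

lemma Rn_subset_span: "Rn n \<subseteq> span (unit_vector ` {..<n})"
proof
  fix x assume "x \<in> Rn n"
  then have "x = (\<Sum>k<n. x k *\<^sub>R unit_vector k)"
  proof (intro ext)
    fix i
    have "(\<Sum>k<n. x k *\<^sub>R unit_vector k) i = (\<Sum>k<n. x k * unit_vector k i)"
      by (induction n) (simp_all add: scaleR_fun_def)
    also have "\<dots> = (\<Sum>k<n. if k = i then x k else 0)"
      by (intro sum.cong) (auto simp: indicator_def)
    also have "\<dots> = x i" using \<open>x \<in> Rn n\<close> by (simp add: Rn_iff)
    finally show "x i = (\<Sum>k<n. x k *\<^sub>R unit_vector k) i" by simp
  qed
  also have "\<dots> \<in> span (unit_vector ` {..<n})"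
    by (intro span_sum span_scale span_base) auto
  finally show "x \<in> span (unit_vector ` {..<n})" .
qed

text \<open>A hyperplane can be given by different equations, whose sides have to be compared. If
  \<open>f\<close> changed sign between \<open>x\<close> and \<open>y\<close>, it would vanish on
  the segment and \<open>g\<close> with it, but \<open>g\<close> keeps its sign there.\<close>

lemma same_zeros_same_side:
  fixes f g :: "'v::real_vector \<Rightarrow> real"
  assumes E: "affine E" and f: "affine_fun f" and g: "affine_fun g"
    and zeros: "\<And>z. z \<in> E \<Longrightarrow> f z = 0 \<Longrightarrow> g z = 0"
    and xy: "x \<in> E" "y \<in> E" "g x \<noteq> 0" "g y \<noteq> 0" "g x > 0 \<longleftrightarrow> g y > 0"
  shows "f x > 0 \<longleftrightarrow> f y > 0"
proof (rule ccontr)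
  assume ne: "\<not> ?thesis"
  have fne: "f x \<noteq> 0" "f y \<noteq> 0" using zeros xy by auto
  define t where "t = f x / (f x - f y)"
  have "f x > 0 \<and> f y < 0 \<or> f x < 0 \<and> f y > 0" using ne fne by linarith
  then have t: "0 < t" "t < 1" "f x \<noteq> f y" by (auto simp: t_def divide_simps)
  have "f (x + t *\<^sub>R (y - x)) = f x + t * (f y - f x)" by (rule affine_funD[OF f])
  also have "\<dots> = 0" using t(3) by (simp add: t_def field_simps)
  finally have "g (x + t *\<^sub>R (y - x)) = 0" using zeros affine_line[OF E xy(1,1,2)] by blast
  then show False using segment_same_sign[OF g t(1,2) xy(3-5)] by simp
qed

context braid_deformation
begin

text \<open>A hyperplane given as a set can be written with \<open>(i, j, a)\<close> or with
  \<open>(j, i, - a)\<close>; the choice fixes one equation and thereby its positive side.\<close>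

definition defining_fun :: "(nat \<Rightarrow> real) set \<Rightarrow> (nat \<Rightarrow> real) \<Rightarrow> real"
  where "defining_fun H = (SOME g. \<exists>i j a. i \<noteq> j \<and> i < n \<and> j < n \<and> H = diff_hyperplane n i j a \<and>
    g = (\<lambda>x. x i - x j - a))"

lemma defining_fun_cases:
  assumes "H \<in> \<B>"
  obtains i j a where "i \<noteq> j" "i < n" "j < n" "H = diff_hyperplane n i j a" "a \<in> D i j"
    "defining_fun H = (\<lambda>x. x i - x j - a)"
proof -
  have "\<exists>g. \<exists>i j a. i \<noteq> j \<and> i < n \<and> j < n \<and> H = diff_hyperplane n i j a \<and> g = (\<lambda>x. x i - x j - a)"
    using assms by (elim hyperplane_cases) blast
  from someI_ex[OF this] obtain i j a where
    "i \<noteq> j" "i < n" "j < n" "H = diff_hyperplane n i j a" "defining_fun H = (\<lambda>x. x i - x j - a)"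
    unfolding defining_fun_def by blast
  then show thesis using assms that by (auto simp: offsets_def)
qed

lemma hyperplanes_subset:
  assumes "\<C> \<subseteq> \<B>"
  shows "hyperplanes (Rn n) \<C> defining_fun (unit_vector ` {..<n})"
proof
  show "affine (Rn n)" by (rule affine_Rn)
  show "Rn n \<noteq> {}" by (metis Rn_iff empty_iff zero_fun_def)
  show "finite (unit_vector ` {..<n})" by simp
  show "Rn n \<subseteq> span (unit_vector ` {..<n})" by (rule Rn_subset_span)
  show "finite \<C>" using assms finite_B finite_subset by blast
next
  fix H assume "H \<in> \<C>"
  then obtain i j a where H: "i \<noteq> j" "i < n" "j < n" "H = diff_hyperplane n i j a"
    "defining_fun H = (\<lambda>x. x i - x j - a)"
    using assms by (meson defining_fun_cases subsetD)
  show "affine_fun (defining_fun H)" unfolding H(5) by (rule affine_fun_diff)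
  show "H = {x \<in> Rn n. defining_fun H x = 0}" unfolding H(5) by (auto simp: H(4) diff_hyperplane_def)
  have val: "(c *\<^sub>R unit_vector i) i - (c *\<^sub>R unit_vector i) j = c" for c :: real
    using H(1) by (simp add: scaleR_fun_def)
  have "a *\<^sub>R unit_vector i \<in> H"
    using val unit_vector_Rn[OF H(2)] by (simp add: H(4) diff_hyperplane_def)
  then show "H \<noteq> {}" by blast
  have "(a + 1) *\<^sub>R unit_vector i \<notin> H" using val[of "a + 1"] by (simp add: H(4) diff_hyperplane_def)
  then show "H \<noteq> Rn n" using unit_vector_Rn[OF H(2)] by metis
qed

text \<open>On \<open>diag_subspace n S\<close> the difference \<open>x i - x j\<close> is
  identically \<open>0\<close> if both indices lie in \<open>S\<close>; otherwise it takes every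
  real value, so the subspace meets the hyperplane without lying in it.\<close>

lemma localization_diag_iff:
  assumes "i \<noteq> j" "i < n" "j < n" "diff_hyperplane n i j a \<in> \<B>"
  shows "diff_hyperplane n i j a \<in> localization \<B> (diag_subspace n S) \<longleftrightarrow> i \<in> S \<and> j \<in> S"
proof
  assume ij: "i \<in> S \<and> j \<in> S"
  have "x \<in> Rn n \<and> x i - x j = 0" if "x \<in> diag_subspace n S" for x
    using ij that unfolding diag_subspace_def by simp
  then show "diff_hyperplane n i j a \<in> localization \<B> (diag_subspace n S)"
    using assms(4) by (cases "a = 0") (auto simp: localization_def diff_hyperplane_def)
next
  assume loc: "diff_hyperplane n i j a \<in> localization \<B> (diag_subspace n S)"
  have V: "c *\<^sub>R unit_vector k \<in> diag_subspace n S" if "k \<notin> S" "k < n" for c k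
  proof -
    have "(c *\<^sub>R unit_vector k) l = 0" if "l \<in> S" for l
      using that \<open>k \<notin> S\<close> by (auto simp: scaleR_fun_def indicator_def)
    then show ?thesis using unit_vector_Rn[OF \<open>k < n\<close>, of c] unfolding diag_subspace_def by simp
  qed
  have all: "diag_subspace n S \<subseteq> diff_hyperplane n i j a"
    if "v \<in> diag_subspace n S" "v \<in> diff_hyperplane n i j a" for v
    using loc that by (auto simp: localization_def)
  show "i \<in> S \<and> j \<in> S"
  proof (rule ccontr)
    assume "\<not> ?thesis"
    then consider "i \<notin> S" | "j \<notin> S" by blast
    then show False
    proof cases
      case 1
      have in_H: "c *\<^sub>R unit_vector i \<in> diff_hyperplane n i j a \<longleftrightarrow> c = a" for c
        using unit_vector_Rn[OF assms(2), of c] assms(1) by (auto simp: diff_hyperplane_def scaleR_fun_def)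
      have "(a + 1) *\<^sub>R unit_vector i \<in> diff_hyperplane n i j a"
        using all[of "a *\<^sub>R unit_vector i"] V[OF 1 assms(2)] in_H by blast
      then show False using in_H[of "a + 1"] by simp
    next
      case 2
      have in_H: "c *\<^sub>R unit_vector j \<in> diff_hyperplane n i j a \<longleftrightarrow> c = - a" for c
        using unit_vector_Rn[OF assms(3), of c] assms(1) by (auto simp: diff_hyperplane_def scaleR_fun_def)
      have "(1 - a) *\<^sub>R unit_vector j \<in> diff_hyperplane n i j a"
        using all[of "(- a) *\<^sub>R unit_vector j"] V[OF 2 assms(3)] in_H by blast
      then show False using in_H[of "1 - a"] by simp
    qed
  qed
qed

text \<open>With this, \<open>card_chambers_localization\<close> also covers the whole
  arrangement.\<close>

lemma localization_full: "localization \<B> (diag_subspace n {..<n}) = \<B>"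
proof
  show "\<B> \<subseteq> localization \<B> (diag_subspace n {..<n})"
  proof
    fix H assume H: "H \<in> \<B>"
    then obtain i j a where "i \<noteq> j" "i < n" "j < n" "H = diff_hyperplane n i j a"
      by (rule hyperplane_cases)
    then show "H \<in> localization \<B> (diag_subspace n {..<n})"
      using localization_diag_iff[of i j a "{..<n}"] H by simp
  qed
qed (auto simp: localization_def)

text \<open>Sign vectors and patterns both record the side of each hyperplane on which a point lies,
  so they identify the same generic points.\<close>

lemma card_chambers_localization:
  assumes S: "S \<subseteq> {..<n}"
  shows "card (chambers (Rn n) defining_fun (localization \<B> (diag_subspace n S))) = card (patterns D S)"
proof -
  let ?L = "localization \<B> (diag_subspace n S)"
  let ?G = "{x \<in> Rn n. generic D S x}"
  have sub: "?L \<subseteq> \<B>" by (auto simp: localization_def)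
  interpret h: hyperplanes "Rn n" \<B> defining_fun "unit_vector ` {..<n}"
    using hyperplanes_subset by blast
  have L_cases: thesis if "H \<in> ?L" and
    "\<And>i j a. i \<in> S \<Longrightarrow> j \<in> S \<Longrightarrow> i \<noteq> j \<Longrightarrow> a \<in> D i j \<Longrightarrow> H = diff_hyperplane n i j a \<Longrightarrow>
      defining_fun H = (\<lambda>x. x i - x j - a) \<Longrightarrow> thesis" for H thesis
  proof -
    have H: "H \<in> \<B>" using that(1) sub by auto
    then obtain i j a where *: "i \<noteq> j" "i < n" "j < n" "H = diff_hyperplane n i j a" "a \<in> D i j"
      "defining_fun H = (\<lambda>x. x i - x j - a)" by (rule defining_fun_cases)
    moreover have "i \<in> S \<and> j \<in> S" using localization_diag_iff[OF *(1-3)] *(4) H that(1) by simp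
    ultimately show thesis using that(2) by blast
  qed
  have L_mem: "diff_hyperplane n i j a \<in> ?L" if "i \<in> S" "j \<in> S" "i \<noteq> j" "a \<in> D i j" for i j a
    using localization_diag_iff[of i j a S] that S by (auto simp: offsets_def)
  have generic_iff: "generic D S x \<longleftrightarrow> (\<forall>H\<in>?L. defining_fun H x \<noteq> 0)" if x: "x \<in> Rn n" for x
  proof
    assume gen: "generic D S x"
    show "\<forall>H\<in>?L. defining_fun H x \<noteq> 0"
    proof
      fix H assume "H \<in> ?L"
      then show "defining_fun H x \<noteq> 0"
        by (rule L_cases) (use gen in \<open>auto simp: generic_def\<close>)
    qed
  next
    assume nz: "\<forall>H\<in>?L. defining_fun H x \<noteq> 0"
    show "generic D S x"
      unfolding generic_def
    proof (intro ballI impI notI)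
      fix i j assume ij: "i \<in> S" "j \<in> S" "i \<noteq> j" "x i - x j \<in> D i j"
      then have L: "diff_hyperplane n i j (x i - x j) \<in> ?L" by (rule L_mem)
      have "x \<in> diff_hyperplane n i j (x i - x j)" using x by (simp add: diff_hyperplane_def)
      then have "defining_fun (diff_hyperplane n i j (x i - x j)) x = 0"
        using h.H_eq L sub by blast
      then show False using nz L by blast
    qed
  qed
  have "card ((\<lambda>x. {H \<in> ?L. defining_fun H x > 0}) ` ?G) = card (pattern D S ` ?G)"
  proof (rule card_image_cong_kernel)
    fix x y assume x: "x \<in> ?G" and y: "y \<in> ?G"
    show "{H \<in> ?L. defining_fun H x > 0} = {H \<in> ?L. defining_fun H y > 0} \<longleftrightarrow>
        pattern D S x = pattern D S y"
    proof
      assume eq: "pattern D S x = pattern D S y"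
      have "defining_fun H x > 0 \<longleftrightarrow> defining_fun H y > 0" if H: "H \<in> ?L" for H
        using H
      proof (rule L_cases)
        fix i j a assume *: "i \<in> S" "j \<in> S" "i \<noteq> j" "a \<in> D i j" "defining_fun H = (\<lambda>x. x i - x j - a)"
        have "(i, j, a) \<in> pattern D S x \<longleftrightarrow> (i, j, a) \<in> pattern D S y" using eq by simp
        then have "x i - x j < a \<longleftrightarrow> y i - y j < a" using * by (simp add: pattern_def)
        moreover have "x i - x j \<noteq> a" "y i - y j \<noteq> a" using x y * by (auto simp: generic_def)
        ultimately show ?thesis unfolding *(5) by auto
      qed
      then show "{H \<in> ?L. defining_fun H x > 0} = {H \<in> ?L. defining_fun H y > 0}" by auto
    next
      assume eq: "{H \<in> ?L. defining_fun H x > 0} = {H \<in> ?L. defining_fun H y > 0}"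
      have side: "x i - x j < a \<longleftrightarrow> y i - y j < a" if ij: "i \<in> S" "j \<in> S" "i \<noteq> j" "a \<in> D i j" for i j a
      proof -
        let ?H = "diff_hyperplane n i j a"
        have L: "?H \<in> ?L" using L_mem[OF ij] .
        then have HB: "?H \<in> \<B>" using sub by auto
        have sxy: "defining_fun ?H x > 0 \<longleftrightarrow> defining_fun ?H y > 0" using eq L by auto
        have nz: "defining_fun ?H x \<noteq> 0" "defining_fun ?H y \<noteq> 0" using generic_iff x y L by auto
        have z: "defining_fun ?H z = 0" if "z \<in> Rn n" "z j - z i - (- a) = 0" for z
        proof -
          have "z \<in> ?H" using that by (simp add: diff_hyperplane_def)
          then show ?thesis using h.H_eq[OF HB] by blast
        qed
        \<comment> \<open>This expression is positive exactly when \<open>x i - x j < a\<close>, and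
          it vanishes on the same hyperplane as \<open>defining_fun ?H\<close>, whichever
          orientation was chosen there.\<close>
        have "x j - x i - (- a) > 0 \<longleftrightarrow> y j - y i - (- a) > 0"
          using x y z sxy nz
          by (intro same_zeros_same_side[OF affine_Rn[of n] affine_fun_diff h.aff[OF HB]]) auto
        then show ?thesis by auto
      qed
      then show "pattern D S x = pattern D S y" by (auto simp: pattern_def)
    qed
  qed
  moreover have "?G = {x \<in> Rn n. \<forall>H\<in>?L. defining_fun H x \<noteq> 0}" using generic_iff by blast
  ultimately show ?thesis unfolding patterns_Rn[OF S] chambers_def by simp
qed

end

section \<open>Comparison of different indices of the sequence\<close>

lemma exponential_sequence_braid_deformation:
  "exponential_sequence \<A> \<Longrightarrow> braid_deformation n (\<A> n)"
  by (simp add: exponential_sequence_def braid_deformation_def)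

text \<open>The isomorphism of the posets of flats enters here: through
  \<open>card_chambers_flats_iso\<close> it equates the total numbers of regions.\<close>

lemma exponential_sequence_card_patterns:
  assumes exp: "exponential_sequence \<A>" and S: "S \<subseteq> {..<n}"
  shows "card (patterns (offsets n (\<A> n)) S) =
    card (patterns (offsets (card S) (\<A> (card S))) {..<card S})"
proof -
  let ?m = "card S"
  interpret a: braid_deformation n "\<A> n" using exp by (rule exponential_sequence_braid_deformation)
  interpret b: braid_deformation ?m "\<A> ?m" using exp by (rule exponential_sequence_braid_deformation)
  have "localization (\<A> n) (diag_subspace n S) \<subseteq> \<A> n" by (auto simp: localization_def)
  then have h1: "hyperplanes (Rn n) (localization (\<A> n) (diag_subspace n S))
      (a.defining_fun) (unit_vector ` {..<n})"
    by (rule a.hyperplanes_subset)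
  have h2: "hyperplanes (Rn ?m) (\<A> ?m) (b.defining_fun) (unit_vector ` {..<?m})"
    by (rule b.hyperplanes_subset) simp
  have flats: "flats k \<C> = flats_in (Rn k) \<C>" for k \<C>
    by (simp add: flats_def flats_in_def)
  have iso: "rev_incl_iso (flats_in (Rn n) (localization (\<A> n) (diag_subspace n S)))
      (flats_in (Rn ?m) (\<A> ?m))"
    using exp S by (simp add: exponential_sequence_def flats)
  show ?thesis
    using card_chambers_flats_iso[OF h1 h2 iso] a.card_chambers_localization[OF S]
      b.card_chambers_localization[of "{..<?m}"] by (simp add: b.localization_full)
qed

text \<open>The totals on all subsets depend only on their size, so
  \<open>pattern_count_determined\<close> yields equality level by level.\<close>

lemma exponential_sequence_pattern_count:
  assumes exp: "exponential_sequence \<A>" and S: "S \<subseteq> {..<n}"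
  shows "pattern_count (offsets n (\<A> n)) S l = num_regions_of_level l (card S) (\<A> (card S))"
proof -
  let ?m = "card S" and ?t = "\<lambda>k. card (patterns (offsets k (\<A> k)) {..<k})"
  interpret a: braid_deformation n "\<A> n" using exp by (rule exponential_sequence_braid_deformation)
  interpret b: braid_deformation ?m "\<A> ?m" using exp by (rule exponential_sequence_braid_deformation)
  have "pattern_count (offsets n (\<A> n)) S l = pattern_count (offsets ?m (\<A> ?m)) {..<?m} l"
    by (rule pattern_count_determined[OF a.differences_axioms b.differences_axioms, of ?t])
      (fact exponential_sequence_card_patterns[OF exp] S order_refl card_lessThan[symmetric])+
  then show ?thesis by (simp add: b.num_regions_of_level_eq)
qed

section \<open>Binomial convolution and generating functions\<close>

lemma sum_Pow_card:
  fixes g :: "nat \<Rightarrow> nat"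
  assumes "finite A"
  shows "(\<Sum>T\<in>Pow A. g (card T)) = (\<Sum>i=0..card A. (card A choose i) * g i)"
proof -
  have "(\<Sum>T\<in>Pow A. g (card T)) = (\<Sum>i\<in>{0..card A}. \<Sum>T\<in>{T \<in> Pow A. card T = i}. g (card T))"
    using assms by (intro sum.group[symmetric]) (auto intro: card_mono)
  also have "\<dots> = (\<Sum>i=0..card A. (card A choose i) * g i)"
    using n_subsets[OF assms] by (intro sum.cong) auto
  finally show ?thesis .
qed

lemma num_regions_of_level_add:
  assumes exp: "exponential_sequence \<A>"
  shows "num_regions_of_level (k + l) n (\<A> n) =
    (\<Sum>i=0..n. (n choose i) * num_regions_of_level k i (\<A> i)
                             * num_regions_of_level l (n - i) (\<A> (n - i)))"
proof -
  let ?r = "\<lambda>l n. num_regions_of_level l n (\<A> n)"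
  interpret a: braid_deformation n "\<A> n" using exp by (rule exponential_sequence_braid_deformation)
  have "?r (k + l) n = (\<Sum>T\<in>Pow {..<n}.
      pattern_count (offsets n (\<A> n)) T k * pattern_count (offsets n (\<A> n)) ({..<n} - T) l)"
    by (simp add: a.num_regions_of_level_eq a.pattern_count_add)
  also have "\<dots> = (\<Sum>T\<in>Pow {..<n}. ?r k (card T) * ?r l (n - card T))"
  proof (rule sum.cong[OF refl])
    fix T assume "T \<in> Pow {..<n}"
    then have T: "T \<subseteq> {..<n}" by simp
    then have "card ({..<n} - T) = n - card T" by (simp add: card_Diff_subset finite_subset)
    then show "pattern_count (offsets n (\<A> n)) T k * pattern_count (offsets n (\<A> n)) ({..<n} - T) l =
        ?r k (card T) * ?r l (n - card T)"
      using exponential_sequence_pattern_count[OF exp T, of k]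
        exponential_sequence_pattern_count[OF exp Diff_subset, of n T l] by simp
  qed
  also have "\<dots> = (\<Sum>i=0..n. (n choose i) * (?r k i * ?r l (n - i)))"
    using sum_Pow_card[of "{..<n}" "\<lambda>i. ?r k i * ?r l (n - i)"] by simp
  finally show ?thesis by (simp add: mult.assoc)
qed

text \<open>Division by \<open>fact n\<close> turns the binomial convolution into a product of power
  series.\<close>

lemma level_egf_add:
  assumes "exponential_sequence \<A>"
  shows "level_egf (k + l) \<A> = level_egf k \<A> * level_egf l \<A>"
proof (rule fps_ext)
  fix n
  let ?r = "\<lambda>l n. real (num_regions_of_level l n (\<A> n))"
  have "?r (k + l) n / fact n = (\<Sum>i=0..n. real (n choose i) * ?r k i * ?r l (n - i) / fact n)"
    unfolding num_regions_of_level_add[OF assms, of k l n] by (simp add: sum_divide_distrib)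
  also have "\<dots> = (\<Sum>i=0..n. (?r k i / fact i) * (?r l (n - i) / fact (n - i)))"
    by (intro sum.cong) (auto simp: binomial_fact)
  finally show "fps_nth (level_egf (k + l) \<A>) n = fps_nth (level_egf k \<A> * level_egf l \<A>) n"
    by (simp add: level_egf_def fps_mult_nth)
qed

lemma level_egf_0:
  assumes exp: "exponential_sequence \<A>"
  shows "level_egf 0 \<A> = 1"
proof (rule fps_ext)
  fix n
  interpret a: braid_deformation n "\<A> n" using exp by (rule exponential_sequence_braid_deformation)
  have "num_regions_of_level 0 n (\<A> n) = (if n = 0 then 1 else 0)"
    unfolding a.num_regions_of_level_eq
    by (cases "n = 0") (simp_all add: pattern_count_empty pattern_count_0 lessThan_empty_iff)
  then show "fps_nth (level_egf 0 \<A>) n = fps_nth 1 n" by (simp add: level_egf_def)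
qed

theorem theorem7p4:
  fixes \<A> :: "nat \<Rightarrow> (nat \<Rightarrow> real) set set"
  assumes "exponential_sequence \<A>"
  shows "(\<forall>l. level_egf l \<A> = level_egf 1 \<A> ^ l) \<and>
    (\<forall>l1 l2 n. num_regions_of_level (l1 + l2) n (\<A> n) =
      (\<Sum>i=0..n. (n choose i) * num_regions_of_level l1 i (\<A> i)
                               * num_regions_of_level l2 (n - i) (\<A> (n - i))))"
proof (intro conjI allI)
  fix l show "level_egf l \<A> = level_egf 1 \<A> ^ l"
  proof (induction l)
    case 0
    show ?case by (simp add: level_egf_0[OF assms])
  next
    case (Suc l)
    then show ?case using level_egf_add[OF assms, of 1 l] by simp
  qed
qed (rule num_regions_of_level_add[OF assms])

end
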